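(* The following pairs of categories are co-equivalent (i.e. dually equivalent): (i) $\mathfrak{D}_{0}$ and $\mathfrak{US}$. (ii) $\mathfrak{D}^{1}$ and $\mathfrak{DS}$.
   Context: A lattice is a non-empty poset with binary joins and meets (neither a minimum nor a maximum is required in general). An ideal is a non-empty lower subset closed under finite non-empty joins. A proper ideal $I$ is prime if $a\wedge b\in I$ implies $a\in I$ or $b\in I$. A lattice homomorphism (a map preserving binary meets and joins) is proper if the inverse image of every prime ideal is a prime ideal. $\mathfrak{D}_p$ is the category of distributive lattices and proper homomorphisms. $\mathfrak{D}_0$ (resp. $\mathfrak{D}^1$) is the full subcategory of $\mathfrak{D}_p$ whose objects are the distributive lattices with minimum (resp. with maximum). The prime spectrum of a lattice $L$ is the set of its prime ideals with the topology whose basic open sets are $d(a)=\{I : I\text{ a prime ideal of }L,\ a\notin I\}$, $a\in L$. A Balbes-Dwinger space is a space homeomorphic to the prime spectrum of a distributive lattice. A subset $A$ of a space $X$ is fundamental if either (i) $A$ is non-empty, open and compact, or (ii) $A=\emptyset$ and every non-empty collection of non-empty open compact sets whose intersection is empty has a finite subcollection with empty intersection. A map is strongly continuous if it is continuous and the inverse image of every fundamental set is fundamental. $\mathfrak{BD}$ is the category of Balbes-Dwinger spaces and strongly continuous functions. An irreducible closed set is a non-empty closed set that is not the union of two proper closed subsets. A space is sober if every irreducible closed set is the closure of a unique point; almost-sober if every irreducible closed set other than the whole space is the closure of some point; coherent if it has a basis of open compact sets closed under finite (non-empty) intersections; up-spectral if it is coherent and sober; down-spectral if it is $T_0$, coherent,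 compact and almost-sober. $\mathfrak{US}$ is the full subcategory of $\mathfrak{BD}$ whose objects are the up-spectral spaces (equivalently, the sober Balbes-Dwinger spaces), and $\mathfrak{DS}$ is the full subcategory of $\mathfrak{BD}$ whose objects are the down-spectral spaces (equivalently, the compact Balbes-Dwinger spaces). *)

theory Defs
  imports "HOL-Analysis.Analysis" "HOL-Algebra.Lattice" "HOL-Library.Equipollence"
begin

section \<open>Categories and dual equivalence\<close>

text \<open>Hom-sets need not be disjoint: a morphism carries no record of its domain and codomain, so
  composition and the morphism part of a functor take the objects as arguments.
  \<open>Comp C x y z g f\<close> is \<open>g \<circ> f\<close> for \<open>f : x \<rightarrow> y\<close> and \<open>g : y \<rightarrow> z\<close>.\<close>

record ('o, 'm) category =
  Obj :: "'o set"
  Hom :: "'o \<Rightarrow> 'o \<Rightarrow> 'm set"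
  Id :: "'o \<Rightarrow> 'm"
  Comp :: "'o \<Rightarrow> 'o \<Rightarrow> 'o \<Rightarrow> 'm \<Rightarrow> 'm \<Rightarrow> 'm"

definition is_category :: "('o, 'm) category \<Rightarrow> bool" where
  "is_category C \<longleftrightarrow>
    (\<forall>x\<in>Obj C. Id C x \<in> Hom C x x) \<and>
    (\<forall>x\<in>Obj C. \<forall>y\<in>Obj C. \<forall>z\<in>Obj C. \<forall>f\<in>Hom C x y. \<forall>g\<in>Hom C y z.
       Comp C x y z g f \<in> Hom C x z) \<and>
    (\<forall>x\<in>Obj C. \<forall>y\<in>Obj C. \<forall>f\<in>Hom C x y.
       Comp C x x y f (Id C x) = f \<and> Comp C x y y (Id C y) f = f) \<and>
    (\<forall>w\<in>Obj C. \<forall>x\<in>Obj C. \<forall>y\<in>Obj C. \<forall>z\<in>Obj C.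
       \<forall>f\<in>Hom C w x. \<forall>g\<in>Hom C x y. \<forall>h\<in>Hom C y z.
       Comp C w y z h (Comp C w x y g f) = Comp C w x z (Comp C x y z h g) f)"

definition opposite :: "('o, 'm) category \<Rightarrow> ('o, 'm) category" where
  "opposite C = \<lparr>Obj = Obj C, Hom = (\<lambda>x y. Hom C y x), Id = Id C,
     Comp = (\<lambda>x y z g f. Comp C z y x f g)\<rparr>"

record ('o, 'm, 'p, 'n) funct =
  on_obj :: "'o \<Rightarrow> 'p"
  on_hom :: "'o \<Rightarrow> 'o \<Rightarrow> 'm \<Rightarrow> 'n"

definition is_functor ::
  "('o, 'm) category \<Rightarrow> ('p, 'n) category \<Rightarrow> ('o, 'm, 'p, 'n) funct \<Rightarrow> bool" where
  "is_functor C D F \<longleftrightarrow>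
    (\<forall>x\<in>Obj C. on_obj F x \<in> Obj D) \<and>
    (\<forall>x\<in>Obj C. \<forall>y\<in>Obj C. \<forall>f\<in>Hom C x y.
       on_hom F x y f \<in> Hom D (on_obj F x) (on_obj F y)) \<and>
    (\<forall>x\<in>Obj C. on_hom F x x (Id C x) = Id D (on_obj F x)) \<and>
    (\<forall>x\<in>Obj C. \<forall>y\<in>Obj C. \<forall>z\<in>Obj C. \<forall>f\<in>Hom C x y. \<forall>g\<in>Hom C y z.
       on_hom F x z (Comp C x y z g f) =
       Comp D (on_obj F x) (on_obj F y) (on_obj F z) (on_hom F y z g) (on_hom F x y f))"

definition id_functor :: "('o, 'm, 'o, 'm) funct" where
  "id_functor = \<lparr>on_obj = (\<lambda>x. x), on_hom = (\<lambda>x y f. f)\<rparr>"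

definition comp_functor ::
  "('p, 'n, 'q, 'k) funct \<Rightarrow> ('o, 'm, 'p, 'n) funct \<Rightarrow> ('o, 'm, 'q, 'k) funct" where
  "comp_functor G F = \<lparr>on_obj = (\<lambda>x. on_obj G (on_obj F x)),
     on_hom = (\<lambda>x y f. on_hom G (on_obj F x) (on_obj F y) (on_hom F x y f))\<rparr>"

definition is_isomorphism :: "('o, 'm) category \<Rightarrow> 'o \<Rightarrow> 'o \<Rightarrow> 'm \<Rightarrow> bool" where
  "is_isomorphism C x y f \<longleftrightarrow> f \<in> Hom C x y \<and>
    (\<exists>g\<in>Hom C y x. Comp C x y x g f = Id C x \<and> Comp C y x y f g = Id C y)"

definition naturally_isomorphic ::
  "('o, 'm) category \<Rightarrow> ('p, 'n) category \<Rightarrow>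
   ('o, 'm, 'p, 'n) funct \<Rightarrow> ('o, 'm, 'p, 'n) funct \<Rightarrow> bool" where
  "naturally_isomorphic C D F G \<longleftrightarrow> (\<exists>\<eta>.
    (\<forall>x\<in>Obj C. is_isomorphism D (on_obj F x) (on_obj G x) (\<eta> x)) \<and>
    (\<forall>x\<in>Obj C. \<forall>y\<in>Obj C. \<forall>f\<in>Hom C x y.
       Comp D (on_obj F x) (on_obj G x) (on_obj G y) (on_hom G x y f) (\<eta> x) =
       Comp D (on_obj F x) (on_obj F y) (on_obj G y) (\<eta> y) (on_hom F x y f)))"

definition equivalent_categories :: "('o, 'm) category \<Rightarrow> ('p, 'n) category \<Rightarrow> bool" where
  "equivalent_categories C D \<longleftrightarrow> is_category C \<and> is_category D \<and>
    (\<exists>F G. is_functor C D F \<and> is_functor D C G \<and>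
       naturally_isomorphic C C id_functor (comp_functor G F) \<and>
       naturally_isomorphic D D (comp_functor F G) id_functor)"

definition co_equivalent :: "('o, 'm) category \<Rightarrow> ('p, 'n) category \<Rightarrow> bool" where
  "co_equivalent C D \<longleftrightarrow> equivalent_categories C (opposite D)"


section \<open>Distributive lattices and proper homomorphisms\<close>

definition distributive_lattice :: "'a gorder \<Rightarrow> bool" where
  "distributive_lattice L \<longleftrightarrow> lattice L \<and> carrier L \<noteq> {} \<and>
    (\<forall>x\<in>carrier L. \<forall>y\<in>carrier L. \<forall>z\<in>carrier L.
       x \<sqinter>\<^bsub>L\<^esub> (y \<squnion>\<^bsub>L\<^esub> z) = (x \<sqinter>\<^bsub>L\<^esub> y) \<squnion>\<^bsub>L\<^esub> (x \<sqinter>\<^bsub>L\<^esub> z))"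

definition has_minimum :: "'a gorder \<Rightarrow> bool" where
  "has_minimum L \<longleftrightarrow> (\<exists>x. least L x (carrier L))"

definition has_maximum :: "'a gorder \<Rightarrow> bool" where
  "has_maximum L \<longleftrightarrow> (\<exists>x. greatest L x (carrier L))"

definition lattice_ideal :: "'a gorder \<Rightarrow> 'a set \<Rightarrow> bool" where
  "lattice_ideal L I \<longleftrightarrow> I \<subseteq> carrier L \<and> I \<noteq> {} \<and>
    (\<forall>x\<in>carrier L. \<forall>y\<in>I. x \<sqsubseteq>\<^bsub>L\<^esub> y \<longrightarrow> x \<in> I) \<and>
    (\<forall>F. finite F \<and> F \<noteq> {} \<and> F \<subseteq> I \<longrightarrow> \<Squnion>\<^bsub>L\<^esub>F \<in> I)"

definition prime_lattice_ideal :: "'a gorder \<Rightarrow> 'a set \<Rightarrow> bool" where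
  "prime_lattice_ideal L I \<longleftrightarrow> lattice_ideal L I \<and> I \<noteq> carrier L \<and>
    (\<forall>a\<in>carrier L. \<forall>b\<in>carrier L. a \<sqinter>\<^bsub>L\<^esub> b \<in> I \<longrightarrow> a \<in> I \<or> b \<in> I)"

text \<open>Morphisms are extensional functions (\<open>undefined\<close> off the carrier), so that equality of
  morphisms is equality of maps.\<close>

definition lattice_homs :: "'a gorder \<Rightarrow> 'b gorder \<Rightarrow> ('a \<Rightarrow> 'b) set" where
  "lattice_homs L M = {f \<in> carrier L \<rightarrow>\<^sub>E carrier M. \<forall>x\<in>carrier L. \<forall>y\<in>carrier L.
     f (x \<sqinter>\<^bsub>L\<^esub> y) = f x \<sqinter>\<^bsub>M\<^esub> f y \<and> f (x \<squnion>\<^bsub>L\<^esub> y) = f x \<squnion>\<^bsub>M\<^esub> f y}"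

definition proper_homs :: "'a gorder \<Rightarrow> 'b gorder \<Rightarrow> ('a \<Rightarrow> 'b) set" where
  "proper_homs L M = {f \<in> lattice_homs L M.
     \<forall>P. prime_lattice_ideal M P \<longrightarrow> prime_lattice_ideal L {x \<in> carrier L. f x \<in> P}}"


section \<open>Spaces and strongly continuous maps\<close>

definition prime_spectrum :: "'a gorder \<Rightarrow> 'a set topology" where
  "prime_spectrum L =
     topology_generated_by ((\<lambda>a. {I. prime_lattice_ideal L I \<and> a \<notin> I}) ` carrier L)"

text \<open>Quantifying over lattices with elements in \<open>'b set\<close> is no restriction: a distributive
  lattice \<open>L\<close> is isomorphic to the lattice of the sets \<open>d(a)\<close>, hence to a lattice of subsets of
  any space homeomorphic to the spectrum of \<open>L\<close>.\<close>

definition Balbes_Dwinger_space :: "'b topology \<Rightarrow> bool" where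
  "Balbes_Dwinger_space X \<longleftrightarrow>
    (\<exists>L :: 'b set gorder. distributive_lattice L \<and> X homeomorphic_space prime_spectrum L)"

definition compact_open :: "'b topology \<Rightarrow> 'b set \<Rightarrow> bool" where
  "compact_open X A \<longleftrightarrow> openin X A \<and> compactin X A"

definition fundamental :: "'b topology \<Rightarrow> 'b set \<Rightarrow> bool" where
  "fundamental X A \<longleftrightarrow>
    (A \<noteq> {} \<and> compact_open X A) \<or>
    (A = {} \<and>
      (\<forall>\<U>. \<U> \<noteq> {} \<and> (\<forall>U\<in>\<U>. U \<noteq> {} \<and> compact_open X U) \<and> \<Inter>\<U> = {} \<longrightarrow>
         (\<exists>\<F>. finite \<F> \<and> \<F> \<noteq> {} \<and> \<F> \<subseteq> \<U> \<and> \<Inter>\<F> = {})))"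

definition strongly_continuous_maps :: "'b topology \<Rightarrow> 'c topology \<Rightarrow> ('b \<Rightarrow> 'c) set" where
  "strongly_continuous_maps X Y = {f \<in> extensional (topspace X). continuous_map X Y f \<and>
     (\<forall>A. fundamental Y A \<longrightarrow> fundamental X {x \<in> topspace X. f x \<in> A})}"

definition irreducible_closed :: "'b topology \<Rightarrow> 'b set \<Rightarrow> bool" where
  "irreducible_closed X C \<longleftrightarrow> closedin X C \<and> C \<noteq> {} \<and>
    \<not> (\<exists>A B. closedin X A \<and> closedin X B \<and> A \<subset> C \<and> B \<subset> C \<and> C = A \<union> B)"

definition sober :: "'b topology \<Rightarrow> bool" where
  "sober X \<longleftrightarrow>
    (\<forall>C. irreducible_closed X C \<longrightarrow> (\<exists>!x. x \<in> topspace X \<and> C = X closure_of {x}))"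

definition almost_sober :: "'b topology \<Rightarrow> bool" where
  "almost_sober X \<longleftrightarrow>
    (\<forall>C. irreducible_closed X C \<and> C \<noteq> topspace X \<longrightarrow>
       (\<exists>x. x \<in> topspace X \<and> C = X closure_of {x}))"

definition coherent :: "'b topology \<Rightarrow> bool" where
  "coherent X \<longleftrightarrow>
    (\<exists>\<B>. openin X = arbitrary union_of (\<lambda>U. U \<in> \<B>) \<and> (\<forall>U\<in>\<B>. compact_open X U) \<and>
       (\<forall>\<F>. finite \<F> \<and> \<F> \<noteq> {} \<and> \<F> \<subseteq> \<B> \<longrightarrow> \<Inter>\<F> \<in> \<B>))"

definition up_spectral :: "'b topology \<Rightarrow> bool" where
  "up_spectral X \<longleftrightarrow> coherent X \<and> sober X"

definition down_spectral :: "'b topology \<Rightarrow> bool" where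
  "down_spectral X \<longleftrightarrow> t0_space X \<and> coherent X \<and> compact_space X \<and> almost_sober X"


section \<open>The categories\<close>

text \<open>There is no type of all sets, so the categories are taken relative to a notion of size: a
  lattice is small if its carrier is, and a space is small if it has a small set of fundamental
  subsets. The latter says that the dual lattice is small; if smallness is also preserved by
  power sets, as in a universe, then for \<open>T\<^sub>0\<close> coherent spaces it is the same as having a small
  set of points. Counting fundamental subsets instead of points avoids assuming closure under
  power sets, so \<open>small = (\<lambda>_. True)\<close> over any type \<open>'a\<close> is allowed, and so every lattice
  and every space is covered by some instance. A \<open>T\<^sub>0\<close> space whose fundamental subsets form a
  basis has at most \<open>2\<^sup>\<kappa>\<close> points if there are \<open>\<kappa>\<close> of these subsets, hence points of type
  \<open>'a set\<close> suffice.\<close>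

definition size_notion :: "('a set \<Rightarrow> bool) \<Rightarrow> bool" where
  "size_notion small \<longleftrightarrow> (\<forall>A B. small A \<and> B \<lesssim> A \<longrightarrow> small B)"

definition small_lattice :: "('a set \<Rightarrow> bool) \<Rightarrow> 'a gorder \<Rightarrow> bool" where
  "small_lattice small L \<longleftrightarrow> small (carrier L)"

definition small_space :: "('a set \<Rightarrow> bool) \<Rightarrow> 'a set topology \<Rightarrow> bool" where
  "small_space small X \<longleftrightarrow> (\<exists>A. small A \<and> {U. fundamental X U} \<lesssim> A)"

definition lattice_category ::
  "('a set \<Rightarrow> bool) \<Rightarrow> ('a gorder \<Rightarrow> bool) \<Rightarrow> ('a gorder, 'a \<Rightarrow> 'a) category" where
  "lattice_category small P =
    \<lparr>Obj = {L. distributive_lattice L \<and> P L \<and> small_lattice small L},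
     Hom = proper_homs,
     Id = (\<lambda>L. restrict (\<lambda>x. x) (carrier L)),
     Comp = (\<lambda>L M N g f. compose (carrier L) g f)\<rparr>"

definition space_category ::
  "('a set \<Rightarrow> bool) \<Rightarrow> ('a set topology \<Rightarrow> bool) \<Rightarrow>
   ('a set topology, 'a set \<Rightarrow> 'a set) category" where
  "space_category small P =
    \<lparr>Obj = {X. P X \<and> small_space small X},
     Hom = strongly_continuous_maps,
     Id = (\<lambda>X. restrict (\<lambda>x. x) (topspace X)),
     Comp = (\<lambda>X Y Z g f. compose (topspace X) g f)\<rparr>"

definition D_p :: "('a set \<Rightarrow> bool) \<Rightarrow> ('a gorder, 'a \<Rightarrow> 'a) category" where
  "D_p small = lattice_category small (\<lambda>_. True)"

definition D_min :: "('a set \<Rightarrow> bool) \<Rightarrow> ('a gorder, 'a \<Rightarrow> 'a) category" where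
  "D_min small = lattice_category small has_minimum"

definition D_max :: "('a set \<Rightarrow> bool) \<Rightarrow> ('a gorder, 'a \<Rightarrow> 'a) category" where
  "D_max small = lattice_category small has_maximum"

definition BD :: "('a set \<Rightarrow> bool) \<Rightarrow> ('a set topology, 'a set \<Rightarrow> 'a set) category" where
  "BD small = space_category small Balbes_Dwinger_space"

text \<open>Up-spectral and down-spectral spaces are Balbes-Dwinger spaces, so the next two are full
  subcategories of \<^term>\<open>BD small\<close>; this is not built into their definition.\<close>

definition US :: "('a set \<Rightarrow> bool) \<Rightarrow> ('a set topology, 'a set \<Rightarrow> 'a set) category" where
  "US small = space_category small up_spectral"

definition DS :: "('a set \<Rightarrow> bool) \<Rightarrow> ('a set topology, 'a set \<Rightarrow> 'a set) category" where
  "DS small = space_category small down_spectral"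

end

theory Submission
  imports Defs
begin

text \<open>Both equivalences are instances of one Stone duality. A distributive lattice is sent to its
  prime spectrum, and a \<open>T\<^sub>0\<close>, coherent, almost-sober space to the lattice of its fundamental
  subsets. The fundamental subsets of a spectrum are exactly the sets \<open>d(a)\<close>: compactness of
  \<open>d(a)\<close>, and the fact that the empty set is fundamental precisely when the lattice has a minimum,
  both come from separating ideals and filters by prime ideals. Conversely a prime ideal of
  fundamental sets is the ideal of those missing a unique point, namely the generic point of the
  complement of its union; the only ideal not reached by almost-soberness is the one consisting of
  the empty set alone, and for it the definition of fundamental supplies the point. A minimum of
  the lattice corresponds to soberness, a maximum to compactness.\<close>

section \<open>Prime ideals of distributive lattices\<close>

text \<open>Two obstacles shape the argument. For the same reason the homomorphism induced by a map
  \<open>f\<close> of spaces is not obviously proper; this comes from the identification of prime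
  ideals with points, under which the inverse image of the ideal of \<open>x\<close> is the ideal of
  \<open>f x\<close>. The other obstacle is closure of the fundamental sets under intersection. When
  two non-empty ones are disjoint, the empty set has to be shown fundamental, and this cannot be
  done inside the fundamental sets, which are not yet known to form a lattice. The proof moves to
  all compact open sets, among which the empty set is always the minimum, and applies separation
  there. Disjointness of two non-empty sets is what makes almost-soberness sufficient at that
  point.\<close>

locale distr_lattice = lattice L for L :: "'a gorder" (structure) +
  assumes nonempty: "carrier L \<noteq> {}"
    and meet_join_distrib: "\<lbrakk>x \<in> carrier L; y \<in> carrier L; z \<in> carrier L\<rbrakk>
      \<Longrightarrow> x \<sqinter> (y \<squnion> z) = (x \<sqinter> y) \<squnion> (x \<sqinter> z)"

lemma distributive_lattice_iff: "distributive_lattice L \<longleftrightarrow> distr_lattice L"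
  by (auto simp: distributive_lattice_def distr_lattice_def distr_lattice_axioms_def)

context lattice
begin

lemma meet_eqI:
  assumes "x \<in> carrier L" "y \<in> carrier L" "z \<in> carrier L" "z \<sqsubseteq> x" "z \<sqsubseteq> y"
    and "\<And>w. \<lbrakk>w \<in> carrier L; w \<sqsubseteq> x; w \<sqsubseteq> y\<rbrakk> \<Longrightarrow> w \<sqsubseteq> z"
  shows "x \<sqinter> y = z"
  by (meson assms le_antisym meet_closed meet_le meet_left meet_right)

lemma join_eqI:
  assumes "x \<in> carrier L" "y \<in> carrier L" "z \<in> carrier L" "x \<sqsubseteq> z" "y \<sqsubseteq> z"
    and "\<And>w. \<lbrakk>w \<in> carrier L; x \<sqsubseteq> w; y \<sqsubseteq> w\<rbrakk> \<Longrightarrow> z \<sqsubseteq> w"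
  shows "x \<squnion> y = z"
  by (meson assms le_antisym join_closed join_le join_left join_right)

lemma join_mono:
  assumes "a \<sqsubseteq> b" "c \<sqsubseteq> d" "a \<in> carrier L" "b \<in> carrier L" "c \<in> carrier L" "d \<in> carrier L"
  shows "a \<squnion> c \<sqsubseteq> b \<squnion> d"
proof (rule join_le)
  show "a \<sqsubseteq> b \<squnion> d" by (rule le_trans[OF assms(1) join_left]) (use assms in auto)
  show "c \<sqsubseteq> b \<squnion> d" by (rule le_trans[OF assms(2) join_right]) (use assms in auto)
qed (use assms in auto)

lemma meet_mono:
  assumes "a \<sqsubseteq> b" "c \<sqsubseteq> d" "a \<in> carrier L" "b \<in> carrier L" "c \<in> carrier L" "d \<in> carrier L"
  shows "a \<sqinter> c \<sqsubseteq> b \<sqinter> d"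
proof (rule meet_le)
  show "a \<sqinter> c \<sqsubseteq> b" by (rule le_trans[OF meet_left assms(1)]) (use assms in auto)
  show "a \<sqinter> c \<sqsubseteq> d" by (rule le_trans[OF meet_right assms(2)]) (use assms in auto)
qed (use assms in auto)

end

context distr_lattice
begin

text \<open>Reduces finite joins to binary ones. For the converse, induction produces an upper bound
  of \<open>F\<close> inside \<open>I\<close>; the supremum lies below it and is therefore in
  \<open>I\<close>, so the supremum itself need not be computed step by step.\<close>

lemma lattice_ideal_iff:
  "lattice_ideal L I \<longleftrightarrow> I \<subseteq> carrier L \<and> I \<noteq> {} \<and>
    (\<forall>x\<in>carrier L. \<forall>y\<in>I. x \<sqsubseteq> y \<longrightarrow> x \<in> I) \<and> (\<forall>x\<in>I. \<forall>y\<in>I. x \<squnion> y \<in> I)"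
proof
  assume I: "lattice_ideal L I"
  have "x \<squnion> y \<in> I" if "x \<in> I" "y \<in> I" for x y
    using I that unfolding lattice_ideal_def join_def by simp
  with I show "I \<subseteq> carrier L \<and> I \<noteq> {} \<and>
    (\<forall>x\<in>carrier L. \<forall>y\<in>I. x \<sqsubseteq> y \<longrightarrow> x \<in> I) \<and> (\<forall>x\<in>I. \<forall>y\<in>I. x \<squnion> y \<in> I)"
    unfolding lattice_ideal_def by blast
next
  assume I: "I \<subseteq> carrier L \<and> I \<noteq> {} \<and>
    (\<forall>x\<in>carrier L. \<forall>y\<in>I. x \<sqsubseteq> y \<longrightarrow> x \<in> I) \<and> (\<forall>x\<in>I. \<forall>y\<in>I. x \<squnion> y \<in> I)"
  have ub: "\<exists>s\<in>I. \<forall>x\<in>F. x \<sqsubseteq> s" if "finite F" "F \<noteq> {}" "F \<subseteq> I" for F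
    using that
  proof (induction F rule: finite_ne_induct)
    case (singleton x)
    then show ?case using I le_refl by blast
  next
    case (insert x F)
    then obtain s where s: "s \<in> I" "\<forall>x\<in>F. x \<sqsubseteq> s" by auto
    have "x \<in> I" "x \<in> carrier L" "s \<in> carrier L" "F \<subseteq> carrier L"
      using insert.prems I s by auto
    then have "\<forall>z\<in>insert x F. z \<sqsubseteq> x \<squnion> s"
      using s by (auto intro: join_left le_trans[OF _ join_right])
    then show ?case using \<open>x \<in> I\<close> s I by blast
  qed
  have "\<Squnion>F \<in> I" if F: "finite F" "F \<noteq> {}" "F \<subseteq> I" for F
  proof -
    obtain s where s: "s \<in> I" "\<forall>x\<in>F. x \<sqsubseteq> s" using ub[OF F] by blast
    have FL: "F \<subseteq> carrier L" using F I by blast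
    have "\<Squnion>F \<sqsubseteq> s"
      by (rule least_le[OF finite_sup_least]) (use F FL s I in \<open>auto simp: Upper_def\<close>)
    moreover have "\<Squnion>F \<in> carrier L" using F FL by auto
    ultimately show ?thesis using I s by blast
  qed
  then show "lattice_ideal L I" using I unfolding lattice_ideal_def by blast
qed

lemma prime_lattice_ideal_iff:
  "prime_lattice_ideal L I \<longleftrightarrow> I \<subseteq> carrier L \<and> I \<noteq> {} \<and> I \<noteq> carrier L \<and>
    (\<forall>x\<in>carrier L. \<forall>y\<in>I. x \<sqsubseteq> y \<longrightarrow> x \<in> I) \<and> (\<forall>x\<in>I. \<forall>y\<in>I. x \<squnion> y \<in> I) \<and>
    (\<forall>a\<in>carrier L. \<forall>b\<in>carrier L. a \<sqinter> b \<in> I \<longrightarrow> a \<in> I \<or> b \<in> I)"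
  unfolding prime_lattice_ideal_def lattice_ideal_iff by blast

lemma prime_ideal_subset: "prime_lattice_ideal L P \<Longrightarrow> P \<subseteq> carrier L"
  and prime_ideal_nonempty: "prime_lattice_ideal L P \<Longrightarrow> \<exists>x. x \<in> P"
  by (simp_all add: prime_lattice_ideal_def lattice_ideal_def ex_in_conv)

lemma prime_ideal_proper: "prime_lattice_ideal L P \<Longrightarrow> \<exists>x\<in>carrier L. x \<notin> P"
  using prime_ideal_subset[of P] by (auto simp: prime_lattice_ideal_def)

lemma prime_ideal_downward:
  assumes "prime_lattice_ideal L P" "x \<in> carrier L" "y \<in> P" "x \<sqsubseteq> y"
  shows "x \<in> P"
proof -
  have "\<forall>x\<in>carrier L. \<forall>y\<in>P. x \<sqsubseteq> y \<longrightarrow> x \<in> P"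
    using assms(1) by (simp add: prime_lattice_ideal_def lattice_ideal_def)
  then show ?thesis using assms by blast
qed

lemma prime_ideal_join_iff:
  assumes P: "prime_lattice_ideal L P" and xy: "x \<in> carrier L" "y \<in> carrier L"
  shows "x \<squnion> y \<in> P \<longleftrightarrow> x \<in> P \<and> y \<in> P"
proof
  assume "x \<squnion> y \<in> P"
  then show "x \<in> P \<and> y \<in> P"
    using prime_ideal_downward[OF P] xy join_left join_right by metis
next
  have "\<forall>x\<in>P. \<forall>y\<in>P. x \<squnion> y \<in> P"
    using P[unfolded prime_lattice_ideal_iff] by (elim conjE)
  then show "x \<in> P \<and> y \<in> P \<Longrightarrow> x \<squnion> y \<in> P" by blast
qed

lemma prime_ideal_meet_iff:
  assumes P: "prime_lattice_ideal L P" and xy: "x \<in> carrier L" "y \<in> carrier L"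
  shows "x \<sqinter> y \<in> P \<longleftrightarrow> x \<in> P \<or> y \<in> P"
proof
  have "\<forall>a\<in>carrier L. \<forall>b\<in>carrier L. a \<sqinter> b \<in> P \<longrightarrow> a \<in> P \<or> b \<in> P"
    using P unfolding prime_lattice_ideal_def by (elim conjE)
  then show "x \<sqinter> y \<in> P \<Longrightarrow> x \<in> P \<or> y \<in> P" using xy by blast
next
  assume "x \<in> P \<or> y \<in> P"
  then show "x \<sqinter> y \<in> P"
    using prime_ideal_downward[OF P] xy meet_closed meet_left meet_right by metis
qed

lemma distributive: "distributive_lattice L"
  unfolding distributive_lattice_iff by (rule distr_lattice_axioms)

text \<open>The direction of the dual distributive law that the primality argument below consumes.
  Distributing twice on the left leaves three terms, each of them below the right side.\<close>

lemma join_meet_le: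
  assumes r: "r \<in> carrier L" and a: "a \<in> carrier L" and b: "b \<in> carrier L"
  shows "(r \<squnion> a) \<sqinter> (r \<squnion> b) \<sqsubseteq> r \<squnion> (a \<sqinter> b)"
proof -
  have 1: "(r \<squnion> a) \<sqinter> (r \<squnion> b) = ((r \<squnion> a) \<sqinter> r) \<squnion> ((r \<squnion> a) \<sqinter> b)"
    by (rule meet_join_distrib) (use r a b in auto)
  have 2: "(r \<squnion> a) \<sqinter> b = (b \<sqinter> r) \<squnion> (b \<sqinter> a)"
    unfolding meet_comm[of L "r \<squnion> a"] by (rule meet_join_distrib) (use r a b in auto)
  have 3: "(r \<squnion> a) \<sqinter> r \<sqsubseteq> r \<squnion> (a \<sqinter> b)"
    by (rule le_trans[OF meet_right join_left]) (use r a b in auto)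
  have 4: "b \<sqinter> r \<sqsubseteq> r \<squnion> (a \<sqinter> b)"
    by (rule le_trans[OF meet_right join_left]) (use r a b in auto)
  have 5: "b \<sqinter> a \<sqsubseteq> r \<squnion> (a \<sqinter> b)"
    by (simp add: a b join_right meet_comm[of L b a] r)
  show ?thesis
    unfolding 1 2 by (intro join_le 3 4 5) (use r a b in auto)
qed

text \<open>An ideal maximal among those that contain \<open>I\<close> and miss \<open>F\<close> is
  prime: if \<open>a\<close> and \<open>b\<close> are both outside it, enlarging it by either one
  reaches an element of \<open>F\<close>, and the meet of these two elements falls back into the
  ideal as soon as \<open>a \<sqinter> b\<close> is in it. Non-emptiness of \<open>F\<close> keeps
  the ideal proper.\<close>

theorem prime_ideal_separation:
  assumes I: "lattice_ideal L I" and F: "F \<subseteq> carrier L" "F \<noteq> {}"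
    and meetF: "\<And>x y. \<lbrakk>x \<in> F; y \<in> F\<rbrakk> \<Longrightarrow> x \<sqinter> y \<in> F" and disj: "I \<inter> F = {}"
  obtains P where "prime_lattice_ideal L P" "I \<subseteq> P" "P \<inter> F = {}"
proof -
  define \<A> where "\<A> = {J. lattice_ideal L J \<and> I \<subseteq> J \<and> J \<inter> F = {}}"
  \<comment> \<open>Only non-empty chains are bounded by their union: ideals are non-empty, so the
    union of the empty chain is not in \<open>\<A>\<close>.\<close>
  have "\<exists>M\<in>\<A>. \<forall>X\<in>\<A>. M \<subseteq> X \<longrightarrow> X = M"
  proof (rule subset_Zorn_nonempty)
    show "\<A> \<noteq> {}" using I disj by (auto simp: \<A>_def)
    fix \<C> assume ne: "\<C> \<noteq> {}" and ch: "subset.chain \<A> \<C>"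
    have id: "lattice_ideal L J" "I \<subseteq> J" "J \<inter> F = {}" if "J \<in> \<C>" for J
      using ch that by (auto simp: \<A>_def subset.chain_def)
    have lin: "J \<subseteq> K \<or> K \<subseteq> J" if "J \<in> \<C>" "K \<in> \<C>" for J K
      using ch that by (auto simp: subset.chain_def)
    have "x \<squnion> y \<in> \<Union>\<C>" if xy: "x \<in> \<Union>\<C>" "y \<in> \<Union>\<C>" for x y
    proof -
      obtain J K where JK: "J \<in> \<C>" "K \<in> \<C>" "x \<in> J" "y \<in> K" using xy by blast
      then obtain N where "N \<in> \<C>" "x \<in> N" "y \<in> N" using lin by blast
      then show ?thesis using id(1) unfolding lattice_ideal_iff by blast
    qed
    then have "lattice_ideal L (\<Union>\<C>)"
      using ne id(1) unfolding lattice_ideal_iff by blast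
    then show "\<Union>\<C> \<in> \<A>" using ne id(2,3) unfolding \<A>_def by blast
  qed
  then obtain P where P: "P \<in> \<A>" and max: "\<And>X. X \<in> \<A> \<Longrightarrow> P \<subseteq> X \<Longrightarrow> X = P" by blast
  have iP: "P \<subseteq> carrier L" "P \<noteq> {}" "\<And>x y. x \<in> carrier L \<Longrightarrow> y \<in> P \<Longrightarrow> x \<sqsubseteq> y \<Longrightarrow> x \<in> P"
      "\<And>x y. x \<in> P \<Longrightarrow> y \<in> P \<Longrightarrow> x \<squnion> y \<in> P" "I \<subseteq> P" "P \<inter> F = {}"
    using P unfolding \<A>_def lattice_ideal_iff by blast+
  have meets: "\<exists>f\<in>F. \<exists>p\<in>P. f \<sqsubseteq> p \<squnion> a" if a: "a \<in> carrier L" "a \<notin> P" for a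
  proof (rule ccontr)
    assume neg: "\<not> ?thesis"
    \<comment> \<open>The ideal generated by \<open>P\<close> and \<open>a\<close>. If it missed
      \<open>F\<close>, it would be a strictly larger member of \<open>\<A>\<close>.\<close>
    define J where "J = {x \<in> carrier L. \<exists>p\<in>P. x \<sqsubseteq> p \<squnion> a}"
    have PJ: "P \<subseteq> J" unfolding J_def using iP(1) a join_left by blast
    have aJ: "a \<in> J" unfolding J_def using iP(1,2) a join_right by blast
    have "x \<squnion> y \<in> J" if J: "x \<in> J" "y \<in> J" for x y
    proof -
      obtain p q where pq: "p \<in> P" "q \<in> P" "x \<sqsubseteq> p \<squnion> a" "y \<sqsubseteq> q \<squnion> a"
        and xy: "x \<in> carrier L" "y \<in> carrier L" using J by (auto simp: J_def)
      have c: "p \<in> carrier L" "q \<in> carrier L" using pq iP(1) by auto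
      have "p \<squnion> a \<sqsubseteq> (p \<squnion> q) \<squnion> a" "q \<squnion> a \<sqsubseteq> (p \<squnion> q) \<squnion> a"
        by (rule join_mono; use c a in \<open>simp add: join_left join_right\<close>)+
      then have "x \<sqsubseteq> (p \<squnion> q) \<squnion> a" "y \<sqsubseteq> (p \<squnion> q) \<squnion> a"
        using pq(3,4) xy c a(1) by (auto intro: le_trans)
      then have "x \<squnion> y \<sqsubseteq> (p \<squnion> q) \<squnion> a"
        using xy c a(1) by (simp add: join_le)
      then show ?thesis using iP(4)[OF pq(1,2)] xy by (auto simp: J_def)
    qed
    moreover have "x \<in> J" if xy: "x \<in> carrier L" "y \<in> J" "x \<sqsubseteq> y" for x y
    proof -
      obtain p where p: "p \<in> P" "y \<sqsubseteq> p \<squnion> a" "y \<in> carrier L" using xy(2) by (auto simp: J_def)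
      have "x \<sqsubseteq> p \<squnion> a"
        by (rule le_trans[OF xy(3) p(2)]) (use p xy(1) iP(1) a in auto)
      then show ?thesis using p xy(1) by (auto simp: J_def)
    qed
    ultimately have "lattice_ideal L J"
      using aJ unfolding lattice_ideal_iff J_def by blast
    moreover have "J \<inter> F = {}" using neg by (auto simp: J_def)
    ultimately have "J \<in> \<A>" using PJ iP(5) by (auto simp: \<A>_def)
    then have "J = P" using max PJ by blast
    then show False using aJ a by blast
  qed
  have prime: "a \<in> P \<or> b \<in> P" if ab: "a \<in> carrier L" "b \<in> carrier L" "a \<sqinter> b \<in> P" for a b
  proof (rule ccontr)
    assume "\<not> ?thesis"
    then obtain f p g q where fg: "f \<in> F" "g \<in> F" and pq: "p \<in> P" "q \<in> P"
      and le: "f \<sqsubseteq> p \<squnion> a" "g \<sqsubseteq> q \<squnion> b" using meets ab by meson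
    \<comment> \<open>A common bound of \<open>p\<close> and \<open>q\<close> in \<open>P\<close>,
      so that both inequalities have the shape to which \<open>join_meet_le\<close> applies.\<close>
    define r where "r = p \<squnion> q"
    have rP: "r \<in> P" using iP(4) pq by (simp add: r_def)
    have c: "p \<in> carrier L" "q \<in> carrier L" "r \<in> carrier L" "f \<in> carrier L" "g \<in> carrier L"
      using pq fg rP iP(1) F(1) by auto
    have pr: "p \<sqsubseteq> r" "q \<sqsubseteq> r" unfolding r_def using c by (auto intro: join_left join_right)
    have "p \<squnion> a \<sqsubseteq> r \<squnion> a" "q \<squnion> b \<sqsubseteq> r \<squnion> b"
      using pr c ab by (simp_all add: join_mono)
    then have "f \<sqsubseteq> r \<squnion> a" "g \<sqsubseteq> r \<squnion> b"
      using le c ab by (auto intro: le_trans)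
    then have "f \<sqinter> g \<sqsubseteq> (r \<squnion> a) \<sqinter> (r \<squnion> b)"
      using c ab by (simp add: meet_mono)
    then have "f \<sqinter> g \<sqsubseteq> r \<squnion> (a \<sqinter> b)"
      by (rule le_trans[OF _ join_meet_le]) (use c ab in auto)
    with iP(3)[OF _ iP(4)[OF rP ab(3)]] c have "f \<sqinter> g \<in> P" by simp
    then show False using meetF[OF fg] iP(6) by blast
  qed
  have "P \<noteq> carrier L" using F iP(6) by blast
  then have "prime_lattice_ideal L P"
    unfolding prime_lattice_ideal_iff using iP(1,2)
    by (intro conjI ballI impI) (assumption | rule iP(3) iP(4) prime; assumption)+
  then show thesis using that iP(5,6) by blast
qed

lemma principal_ideal:
  assumes "b \<in> carrier L"
  shows "lattice_ideal L {x \<in> carrier L. x \<sqsubseteq> b}"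
  unfolding lattice_ideal_iff
proof (intro conjI ballI impI)
  show "x \<in> {x \<in> carrier L. x \<sqsubseteq> b}"
    if "x \<in> carrier L" "y \<in> {x \<in> carrier L. x \<sqsubseteq> b}" "x \<sqsubseteq> y" for x y
    using that assms le_trans[of x y b] by simp
qed (use assms in \<open>auto simp: join_le\<close>)

end

text \<open>Meets and joins are determined by the order. For prime ideals, surjectivity is what
  makes an inverse image non-empty and different from the whole carrier. Identities, and both
  directions of a lattice isomorphism, become morphisms in this way.\<close>

lemma order_isomorphism_proper:
  assumes "distributive_lattice L" "distributive_lattice M"
    and ext: "h \<in> carrier L \<rightarrow>\<^sub>E carrier M" and bij: "bij_betw h (carrier L) (carrier M)"
    and le: "\<And>x y. \<lbrakk>x \<in> carrier L; y \<in> carrier L\<rbrakk> \<Longrightarrow> h x \<sqsubseteq>\<^bsub>M\<^esub> h y \<longleftrightarrow> x \<sqsubseteq>\<^bsub>L\<^esub> y"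
  shows "h \<in> proper_homs L M"
proof -
  interpret L: distr_lattice L using assms(1) by (simp add: distributive_lattice_iff)
  interpret M: distr_lattice M using assms(2) by (simp add: distributive_lattice_iff)
  have img: "h ` carrier L = carrier M" and inj: "inj_on h (carrier L)"
    using bij by (auto simp: bij_betw_def)
  have hc: "h x \<in> carrier M" if "x \<in> carrier L" for x using ext that by auto
  have meet: "h x \<sqinter>\<^bsub>M\<^esub> h y = h (x \<sqinter>\<^bsub>L\<^esub> y)" if xy: "x \<in> carrier L" "y \<in> carrier L" for x y
  proof (rule M.meet_eqI)
    fix w assume w: "w \<in> carrier M" "w \<sqsubseteq>\<^bsub>M\<^esub> h x" "w \<sqsubseteq>\<^bsub>M\<^esub> h y"
    then obtain v where "v \<in> carrier L" "w = h v" using img by blast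
    then show "w \<sqsubseteq>\<^bsub>M\<^esub> h (x \<sqinter>\<^bsub>L\<^esub> y)" using w xy by (simp add: le L.meet_le)
  qed (use xy in \<open>auto simp: hc le intro: L.meet_left L.meet_right\<close>)
  have join: "h x \<squnion>\<^bsub>M\<^esub> h y = h (x \<squnion>\<^bsub>L\<^esub> y)" if xy: "x \<in> carrier L" "y \<in> carrier L" for x y
  proof (rule M.join_eqI)
    fix w assume w: "w \<in> carrier M" "h x \<sqsubseteq>\<^bsub>M\<^esub> w" "h y \<sqsubseteq>\<^bsub>M\<^esub> w"
    then obtain v where "v \<in> carrier L" "w = h v" using img by blast
    then show "h (x \<squnion>\<^bsub>L\<^esub> y) \<sqsubseteq>\<^bsub>M\<^esub> w" using w xy by (simp add: le L.join_le)
  qed (use xy in \<open>auto simp: hc le intro: L.join_left L.join_right\<close>)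
  have "prime_lattice_ideal L {x \<in> carrier L. h x \<in> P}" if P: "prime_lattice_ideal M P" for P
  proof -
    have ex: "\<exists>x\<in>carrier L. h x \<in> P"
      using M.prime_ideal_nonempty[OF P] M.prime_ideal_subset[OF P] img by (metis imageE subsetD)
    have nex: "\<exists>x\<in>carrier L. h x \<notin> P"
      using M.prime_ideal_proper[OF P] img by (metis imageE)
    show ?thesis
      unfolding L.prime_lattice_ideal_iff
    proof (intro conjI ballI impI)
      show "{x \<in> carrier L. h x \<in> P} \<noteq> {}" "{x \<in> carrier L. h x \<in> P} \<noteq> carrier L"
        using ex nex by auto
      show "x \<in> {x \<in> carrier L. h x \<in> P}"
        if "x \<in> carrier L" "y \<in> {x \<in> carrier L. h x \<in> P}" "x \<sqsubseteq>\<^bsub>L\<^esub> y" for x y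
        using that M.prime_ideal_downward[OF P, of "h x" "h y"] by (simp add: hc le)
    qed (simp_all add: hc M.prime_ideal_join_iff[OF P] M.prime_ideal_meet_iff[OF P] flip: meet join)
  qed
  then show ?thesis
    using ext unfolding proper_homs_def lattice_homs_def by (simp add: meet join)
qed

text \<open>The encoding \<open>e\<close> moves a lattice of sets of points into the type of elements of lattices,
  where the functor from spaces to lattices has to take its values.\<close>

definition set_lattice :: "('b set \<Rightarrow> 'a) \<Rightarrow> 'b set set \<Rightarrow> 'a gorder" where
  "set_lattice e \<S> = \<lparr>carrier = e ` \<S>, eq = (=),
     le = (\<lambda>a b. inv_into \<S> e a \<subseteq> inv_into \<S> e b)\<rparr>"

text \<open>Prime ideals of \<open>\<S>\<close> under inclusion, stated without the encoding, so
  that the topological arguments handle the sets themselves and meet encoded elements only through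
  \<open>prime_ideal_encode_iff\<close> and \<open>prime_ideal_decode\<close>.\<close>

definition prime_set_ideal :: "'b set set \<Rightarrow> 'b set set \<Rightarrow> bool" where
  "prime_set_ideal \<S> Q \<longleftrightarrow> Q \<subseteq> \<S> \<and> Q \<noteq> {} \<and> Q \<noteq> \<S> \<and>
    (\<forall>U\<in>\<S>. \<forall>V\<in>Q. U \<subseteq> V \<longrightarrow> U \<in> Q) \<and> (\<forall>U\<in>Q. \<forall>V\<in>Q. U \<union> V \<in> Q) \<and>
    (\<forall>U\<in>\<S>. \<forall>V\<in>\<S>. U \<inter> V \<in> Q \<longrightarrow> U \<in> Q \<or> V \<in> Q)"

text \<open>A ring of sets with an injective encoding. It is used for the compact open sets with
  \<open>id\<close> and for the fundamental sets with an encoding into the element type of the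
  lattices.\<close>

locale encoded_set_lattice =
  fixes e :: "'b set \<Rightarrow> 'a" and \<S> :: "'b set set"
  assumes inj: "inj_on e \<S>" and nonempty: "\<S> \<noteq> {}"
    and Un: "\<lbrakk>U \<in> \<S>; V \<in> \<S>\<rbrakk> \<Longrightarrow> U \<union> V \<in> \<S>"
    and Int: "\<lbrakk>U \<in> \<S>; V \<in> \<S>\<rbrakk> \<Longrightarrow> U \<inter> V \<in> \<S>"
begin

lemma carrier_set_lattice [simp]: "carrier (set_lattice e \<S>) = e ` \<S>"
  by (simp add: set_lattice_def)

lemma le_iff [simp]:
  "\<lbrakk>U \<in> \<S>; V \<in> \<S>\<rbrakk> \<Longrightarrow> e U \<sqsubseteq>\<^bsub>set_lattice e \<S>\<^esub> e V \<longleftrightarrow> U \<subseteq> V"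
  by (simp add: set_lattice_def inj)

lemma encode_eq_iff [simp]: "\<lbrakk>U \<in> \<S>; V \<in> \<S>\<rbrakk> \<Longrightarrow> e U = e V \<longleftrightarrow> U = V"
  using inj by (simp add: inj_on_eq_iff)

lemma lattice_set_lattice: "lattice (set_lattice e \<S>)"
proof unfold_locales
  let ?L = "set_lattice e \<S>"
  fix x y assume "x \<in> carrier ?L" "y \<in> carrier ?L"
  then obtain U V where UV: "U \<in> \<S>" "V \<in> \<S>" "x = e U" "y = e V" by auto
  have "least ?L (e (U \<union> V)) (Upper ?L {x, y})"
    unfolding least_def Upper_def using UV Un by auto
  then show "\<exists>s. least ?L s (Upper ?L {x, y})" by blast
  have "greatest ?L (e (U \<inter> V)) (Lower ?L {x, y})"
    unfolding greatest_def Lower_def using UV Int by auto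
  then show "\<exists>s. greatest ?L s (Lower ?L {x, y})" by blast
qed (auto simp: set_lattice_def inj)

sublocale lattice "set_lattice e \<S>"
  by (rule lattice_set_lattice)

lemma meet_eq: "\<lbrakk>U \<in> \<S>; V \<in> \<S>\<rbrakk> \<Longrightarrow> e U \<sqinter>\<^bsub>set_lattice e \<S>\<^esub> e V = e (U \<inter> V)"
  by (rule meet_eqI) (auto simp: Int)

lemma join_eq: "\<lbrakk>U \<in> \<S>; V \<in> \<S>\<rbrakk> \<Longrightarrow> e U \<squnion>\<^bsub>set_lattice e \<S>\<^esub> e V = e (U \<union> V)"
  by (rule join_eqI) (auto simp: Un)

sublocale distr_lattice "set_lattice e \<S>"
proof
  show "carrier (set_lattice e \<S>) \<noteq> {}" using nonempty by simp
next
  fix x y z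
  assume "x \<in> carrier (set_lattice e \<S>)" "y \<in> carrier (set_lattice e \<S>)"
    "z \<in> carrier (set_lattice e \<S>)"
  then show "x \<sqinter>\<^bsub>set_lattice e \<S>\<^esub> (y \<squnion>\<^bsub>set_lattice e \<S>\<^esub> z) =
      (x \<sqinter>\<^bsub>set_lattice e \<S>\<^esub> y) \<squnion>\<^bsub>set_lattice e \<S>\<^esub> (x \<sqinter>\<^bsub>set_lattice e \<S>\<^esub> z)"
    by (auto simp: meet_eq join_eq Un Int Int_Un_distrib)
qed

lemma encode_image_mem_iff: "\<lbrakk>U \<in> \<S>; Q \<subseteq> \<S>\<rbrakk> \<Longrightarrow> e U \<in> e ` Q \<longleftrightarrow> U \<in> Q"
  using inj by (rule inj_on_image_mem_iff)

lemma prime_ideal_encode_iff: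
  assumes "Q \<subseteq> \<S>"
  shows "prime_lattice_ideal (set_lattice e \<S>) (e ` Q) \<longleftrightarrow> prime_set_ideal \<S> Q"
proof -
  have "e ` Q = e ` \<S> \<longleftrightarrow> Q = \<S>"
    using inj assms by (simp add: inj_on_image_eq_iff)
  then show ?thesis
    unfolding prime_lattice_ideal_iff prime_set_ideal_def
    using assms
    by (simp add: image_mono meet_eq join_eq encode_image_mem_iff Un Int subsetD[OF assms]
        cong: ball_cong)
qed

lemma prime_ideal_decode:
  assumes "prime_lattice_ideal (set_lattice e \<S>) P"
  obtains Q where "prime_set_ideal \<S> Q" "P = e ` Q"
proof -
  have "P \<subseteq> e ` \<S>" using assms unfolding prime_lattice_ideal_iff by simp
  then obtain Q where "Q \<subseteq> \<S>" "P = e ` Q" by (auto simp: subset_image_iff)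
  then show thesis using that assms prime_ideal_encode_iff by blast
qed

end

section \<open>The prime spectrum\<close>

definition basic_open :: "'a gorder \<Rightarrow> 'a \<Rightarrow> 'a set set" where
  "basic_open L a = {I. prime_lattice_ideal L I \<and> a \<notin> I}"

lemma fundamental_emptyD:
  assumes "fundamental X {}" "\<U> \<noteq> {}" "\<And>U. U \<in> \<U> \<Longrightarrow> U \<noteq> {} \<and> compact_open X U" "\<Inter>\<U> = {}"
  shows "\<exists>\<F>. finite \<F> \<and> \<F> \<noteq> {} \<and> \<F> \<subseteq> \<U> \<and> \<Inter>\<F> = {}"
proof -
  have "\<forall>\<U>. \<U> \<noteq> {} \<and> (\<forall>U\<in>\<U>. U \<noteq> {} \<and> compact_open X U) \<and> \<Inter>\<U> = {} \<longrightarrow>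
         (\<exists>\<F>. finite \<F> \<and> \<F> \<noteq> {} \<and> \<F> \<subseteq> \<U> \<and> \<Inter>\<F> = {})"
    using assms(1) unfolding fundamental_def by simp
  from this[rule_format, of \<U>] show ?thesis using assms(2-4) by simp
qed

lemma fundamental_emptyI:
  assumes "\<And>\<U>. \<lbrakk>\<U> \<noteq> {}; \<And>U. U \<in> \<U> \<Longrightarrow> U \<noteq> {}; \<And>U. U \<in> \<U> \<Longrightarrow> compact_open X U; \<Inter>\<U> = {}\<rbrakk>
    \<Longrightarrow> \<exists>\<F>. finite \<F> \<and> \<F> \<noteq> {} \<and> \<F> \<subseteq> \<U> \<and> \<Inter>\<F> = {}"
  shows "fundamental X {}"
  unfolding fundamental_def
proof (intro disjI2 conjI refl allI impI, elim conjE)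
  fix \<U> assume "\<U> \<noteq> {}" "\<forall>U\<in>\<U>. U \<noteq> {} \<and> compact_open X U" "\<Inter>\<U> = {}"
  then show "\<exists>\<F>. finite \<F> \<and> \<F> \<noteq> {} \<and> \<F> \<subseteq> \<U> \<and> \<Inter>\<F> = {}" by (intro assms) auto
qed

lemma irreducible_closed_cases:
  assumes "irreducible_closed X C" "closedin X A" "closedin X B" "C = A \<union> B"
  shows "A = C \<or> B = C"
  using assms unfolding irreducible_closed_def by blast

section \<open>The sets d(a): order, compactness and fundamental subsets of the spectrum\<close>

context distr_lattice
begin

lemma basic_open_meet:
  "\<lbrakk>a \<in> carrier L; b \<in> carrier L\<rbrakk> \<Longrightarrow> basic_open L (a \<sqinter> b) = basic_open L a \<inter> basic_open L b"
  unfolding basic_open_def using prime_ideal_meet_iff by blast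

lemma basic_open_join:
  "\<lbrakk>a \<in> carrier L; b \<in> carrier L\<rbrakk> \<Longrightarrow> basic_open L (a \<squnion> b) = basic_open L a \<union> basic_open L b"
  unfolding basic_open_def using prime_ideal_join_iff by blast

text \<open>If \<open>a\<close> is not below \<open>b\<close>, the ideal of all elements below
  \<open>b\<close> misses \<open>{a}\<close>; a prime ideal separating the two belongs to
  \<open>basic_open L a\<close> and not to \<open>basic_open L b\<close>.\<close>

lemma basic_open_subset_iff:
  assumes a: "a \<in> carrier L" and b: "b \<in> carrier L"
  shows "basic_open L a \<subseteq> basic_open L b \<longleftrightarrow> a \<sqsubseteq> b"
proof
  assume sub: "basic_open L a \<subseteq> basic_open L b"
  show "a \<sqsubseteq> b"
  proof (rule ccontr)
    assume "\<not> a \<sqsubseteq> b"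
    moreover have "a \<sqinter> a = a" by (rule meet_eqI) (use a in auto)
    ultimately obtain P where P: "prime_lattice_ideal L P" "{x \<in> carrier L. x \<sqsubseteq> b} \<subseteq> P"
        "P \<inter> {a} = {}"
      using prime_ideal_separation[OF principal_ideal[OF b], of "{a}"] a by auto
    then have "a \<notin> P" "b \<in> P" using a b by auto
    then show False using sub P(1) by (auto simp: basic_open_def)
  qed
next
  assume "a \<sqsubseteq> b"
  then show "basic_open L a \<subseteq> basic_open L b"
    unfolding basic_open_def using a prime_ideal_downward by blast
qed

lemma basic_open_eq_iff:
  "\<lbrakk>a \<in> carrier L; b \<in> carrier L\<rbrakk> \<Longrightarrow> basic_open L a = basic_open L b \<longleftrightarrow> a = b"
  using basic_open_subset_iff[of a b] basic_open_subset_iff[of b a] le_antisym by auto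

text \<open>Prime ideals are non-empty lower sets and hence contain a minimum. Together with the
  next lemma: some \<open>basic_open L a\<close> is empty exactly when the lattice has a
  minimum.\<close>

lemma basic_open_least: "least L z (carrier L) \<Longrightarrow> basic_open L z = {}"
  unfolding basic_open_def least_def
  using prime_ideal_nonempty prime_ideal_subset prime_ideal_downward by blast

lemma least_if_basic_open_empty:
  "\<lbrakk>a \<in> carrier L; basic_open L a = {}\<rbrakk> \<Longrightarrow> least L a (carrier L)"
  unfolding least_def using basic_open_subset_iff[of a] by auto

text \<open>The elements whose basic set is finitely covered form an ideal \<open>I\<close>
  containing \<open>B\<close>. If \<open>a\<close> were outside, a prime ideal containing
  \<open>I\<close> and omitting \<open>a\<close> would be a point of \<open>basic_open L a\<close>
  covered by no member of the family.\<close>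

lemma basic_open_finite_subcover:
  assumes a: "a \<in> carrier L" and B: "B \<subseteq> carrier L"
    and cover: "basic_open L a \<subseteq> \<Union>(basic_open L ` B)"
  obtains F where "finite F" "F \<subseteq> B" "basic_open L a \<subseteq> \<Union>(basic_open L ` F)"
proof -
  define I where "I = {x \<in> carrier L. \<exists>F. finite F \<and> F \<subseteq> B \<and> basic_open L x \<subseteq> \<Union>(basic_open L ` F)}"
  have mem_I: "x \<in> I" if "x \<in> carrier L" "finite F" "F \<subseteq> B" "basic_open L x \<subseteq> \<Union>(basic_open L ` F)" for x F
    using that by (auto simp: I_def)
  have BI: "B \<subseteq> I"
  proof
    fix b assume "b \<in> B"
    then show "b \<in> I" using B by (intro mem_I[of _ "{b}"]) auto
  qed
  have "a \<in> I"
  proof (cases "B = {}")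
    \<comment> \<open>For empty \<open>B\<close> the set \<open>I\<close> can be empty and so fail
      to be an ideal. The cover then says that \<open>basic_open L a\<close> is empty, and the empty
      subfamily suffices.\<close>
    case True
    then show ?thesis using a cover by (auto simp: I_def)
  next
    case ne: False
    show ?thesis
    proof (rule ccontr)
      assume "a \<notin> I"
      have "lattice_ideal L I"
        unfolding lattice_ideal_iff
      proof (intro conjI ballI impI)
        show "I \<noteq> {}" using BI ne by blast
        show "I \<subseteq> carrier L" by (auto simp: I_def)
        show "x \<in> I" if xy: "x \<in> carrier L" "y \<in> I" "x \<sqsubseteq> y" for x y
        proof -
          obtain F where F: "finite F" "F \<subseteq> B" "basic_open L y \<subseteq> \<Union>(basic_open L ` F)"
            and "y \<in> carrier L" using xy(2) by (auto simp: I_def)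
          then have "basic_open L x \<subseteq> basic_open L y" using xy by (simp add: basic_open_subset_iff)
          then show ?thesis using F(3) by (intro mem_I[OF xy(1) F(1,2)]) (rule order_trans)
        qed
        show "x \<squnion> y \<in> I" if xy: "x \<in> I" "y \<in> I" for x y
        proof -
          obtain F G where FG: "finite F" "F \<subseteq> B" "basic_open L x \<subseteq> \<Union>(basic_open L ` F)"
            "finite G" "G \<subseteq> B" "basic_open L y \<subseteq> \<Union>(basic_open L ` G)"
            and c: "x \<in> carrier L" "y \<in> carrier L"
            using xy by (auto simp: I_def)
          have "basic_open L (x \<squnion> y) \<subseteq> \<Union>(basic_open L ` (F \<union> G))"
            unfolding basic_open_join[OF c] image_Un Union_Un_distrib
            using FG(3,6) by (rule Un_mono)
          then show ?thesis using c FG by (intro mem_I[of _ "F \<union> G"]) simp_all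
        qed
      qed
      moreover have "a \<sqinter> a = a" by (rule meet_eqI) (use a in auto)
      ultimately obtain P where P: "prime_lattice_ideal L P" "I \<subseteq> P" "P \<inter> {a} = {}"
        using \<open>a \<notin> I\<close> a by (auto elim: prime_ideal_separation[of I "{a}"])
      then have "P \<in> basic_open L a" by (auto simp: basic_open_def)
      then obtain b where "b \<in> B" "P \<in> basic_open L b" using cover by blast
      then show False using BI P(2) by (auto simp: basic_open_def)
    qed
  qed
  then show thesis using that by (auto simp: I_def)
qed

text \<open>Dual to the covering argument. \<open>G\<close> is the filter generated by
  \<open>A\<close>; if no finite intersection is empty, \<open>G\<close> misses the ideal below
  \<open>z\<close>, and a prime ideal disjoint from \<open>G\<close> is a point common to all the
  basic sets. The minimum provides the ideal from which the separation starts.\<close>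

lemma basic_open_finite_intersection:
  assumes z: "least L z (carrier L)" and A: "A \<subseteq> carrier L" "A \<noteq> {}"
    and Inter: "\<Inter>(basic_open L ` A) = {}"
  obtains F where "finite F" "F \<noteq> {}" "F \<subseteq> A" "\<Inter>(basic_open L ` F) = {}"
proof (rule ccontr)
  assume neg: "\<not> thesis"
  define G where "G = {x \<in> carrier L. \<exists>F. finite F \<and> F \<noteq> {} \<and> F \<subseteq> A \<and> \<Inter>(basic_open L ` F) \<subseteq> basic_open L x}"
  have mem_G: "x \<in> G" if "x \<in> carrier L" "finite F" "F \<noteq> {}" "F \<subseteq> A"
      "\<Inter>(basic_open L ` F) \<subseteq> basic_open L x" for x F
    using that by (auto simp: G_def)
  have AG: "A \<subseteq> G"
  proof
    fix b assume "b \<in> A"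
    then show "b \<in> G" using A by (intro mem_G[of _ "{b}"]) auto
  qed
  have zL: "z \<in> carrier L" using z by (auto simp: least_def)
  have meet: "x \<sqinter> y \<in> G" if xy: "x \<in> G" "y \<in> G" for x y
  proof -
    obtain F H where FH: "finite F" "F \<noteq> {}" "F \<subseteq> A" "\<Inter>(basic_open L ` F) \<subseteq> basic_open L x"
      "finite H" "H \<noteq> {}" "H \<subseteq> A" "\<Inter>(basic_open L ` H) \<subseteq> basic_open L y"
      and c: "x \<in> carrier L" "y \<in> carrier L"
      using xy by (auto simp: G_def)
    have "\<Inter>(basic_open L ` (F \<union> H)) \<subseteq> basic_open L (x \<sqinter> y)"
      unfolding basic_open_meet[OF c] image_Un Inter_Un_distrib
      using FH(4,8) by (rule Int_mono)
    then show ?thesis using c FH by (intro mem_G[of _ "F \<union> H"]) simp_all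
  qed
  have disj: "{x \<in> carrier L. x \<sqsubseteq> z} \<inter> G = {}"
  proof (rule ccontr)
    assume "\<not> ?thesis"
    then obtain x where x: "x \<in> carrier L" "x \<sqsubseteq> z" "x \<in> G" by auto
    then obtain F where F: "finite F" "F \<noteq> {}" "F \<subseteq> A"
      and sub: "\<Inter>(basic_open L ` F) \<subseteq> basic_open L x" by (auto simp: G_def)
    have "basic_open L x \<subseteq> basic_open L z" using x zL by (simp add: basic_open_subset_iff)
    then have "\<Inter>(basic_open L ` F) = {}" using sub basic_open_least[OF z] by simp
    then show False using neg that[OF F] by simp
  qed
  have GL: "G \<subseteq> carrier L" by (auto simp: G_def)
  have Gne: "G \<noteq> {}" using AG A by blast
  obtain P where P: "prime_lattice_ideal L P" "P \<inter> G = {}"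
    by (rule prime_ideal_separation[OF principal_ideal[OF zL] GL Gne _ disj]) (auto intro: meet that)
  then have "P \<in> \<Inter>(basic_open L ` A)" using AG by (auto simp: basic_open_def)
  then show False using Inter by blast
qed

text \<open>By \<open>basic_open_meet\<close> the generating sets are closed under binary
  intersection, so they form a base and not merely a subbase.\<close>

lemma openin_prime_spectrum:
  "openin (prime_spectrum L) = arbitrary union_of (\<lambda>U. U \<in> basic_open L ` carrier L)"
proof
  let ?B = "\<lambda>U. U \<in> basic_open L ` carrier L"
  have spec: "prime_spectrum L = topology_generated_by (basic_open L ` carrier L)"
    by (simp add: prime_spectrum_def basic_open_def[abs_def])
  have "istopology (arbitrary union_of ?B)"
  proof (rule istopology_base)
    fix S T assume "?B S" "?B T"
    then show "?B (S \<inter> T)" by (auto simp flip: basic_open_meet)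
  qed
  then have top: "\<And>S T. (arbitrary union_of ?B) S \<Longrightarrow> (arbitrary union_of ?B) T \<Longrightarrow> (arbitrary union_of ?B) (S \<inter> T)"
    "\<And>K. (\<And>S. S \<in> K \<Longrightarrow> (arbitrary union_of ?B) S) \<Longrightarrow> (arbitrary union_of ?B) (\<Union>K)"
    unfolding istopology_def by blast+
  fix S show "openin (prime_spectrum L) S = (arbitrary union_of ?B) S"
  proof
    assume "openin (prime_spectrum L) S"
    then have "generate_topology_on (basic_open L ` carrier L) S"
      by (simp add: spec openin_topology_generated_by_iff)
    then show "(arbitrary union_of ?B) S"
    proof induction
      case (Int a b) then show ?case using top(1) by blast
    next
      case (UN K) then show ?case using top(2) by blast
    qed (auto intro: arbitrary_union_of_inc)
  next
    assume "(arbitrary union_of ?B) S"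
    then show "openin (prime_spectrum L) S"
      unfolding union_of_def spec by (blast intro: openin_Union topology_generated_by_Basis)
  qed
qed

lemma openin_prime_spectrum_iff:
  "openin (prime_spectrum L) W \<longleftrightarrow>
    (\<forall>P\<in>W. \<exists>a\<in>carrier L. P \<in> basic_open L a \<and> basic_open L a \<subseteq> W)"
  unfolding openin_prime_spectrum arbitrary_union_of_alt by blast

lemma openin_basic_open: "a \<in> carrier L \<Longrightarrow> openin (prime_spectrum L) (basic_open L a)"
  unfolding openin_prime_spectrum_iff by blast

lemma topspace_prime_spectrum: "topspace (prime_spectrum L) = {P. prime_lattice_ideal L P}"
proof
  show "topspace (prime_spectrum L) \<subseteq> {P. prime_lattice_ideal L P}"
    unfolding prime_spectrum_def topology_generated_by_topspace by blast
  show "{P. prime_lattice_ideal L P} \<subseteq> topspace (prime_spectrum L)"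
    unfolding prime_spectrum_def topology_generated_by_topspace using prime_ideal_proper by blast
qed

lemma compactin_basic_open:
  assumes a: "a \<in> carrier L"
  shows "compactin (prime_spectrum L) (basic_open L a)"
  unfolding compactin_def
proof (intro conjI allI impI)
  show "basic_open L a \<subseteq> topspace (prime_spectrum L)"
    using openin_basic_open[OF a] by (rule openin_subset)
  fix \<U> assume \<U>: "Ball \<U> (openin (prime_spectrum L)) \<and> basic_open L a \<subseteq> \<Union>\<U>"
  \<comment> \<open>The cover is refined to basic sets, which turns the search for a finite subcover
    into one for finitely many lattice elements.\<close>
  define B where "B = {b \<in> carrier L. \<exists>U\<in>\<U>. basic_open L b \<subseteq> U}"
  have B: "B \<subseteq> carrier L" by (auto simp: B_def)
  have cover: "basic_open L a \<subseteq> \<Union>(basic_open L ` B)"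
  proof
    fix P assume "P \<in> basic_open L a"
    then obtain U where U: "U \<in> \<U>" "P \<in> U" using \<U> by blast
    then have "openin (prime_spectrum L) U" using \<U> by blast
    then obtain b where "b \<in> carrier L" "P \<in> basic_open L b" "basic_open L b \<subseteq> U"
      using U(2) openin_prime_spectrum_iff by meson
    then show "P \<in> \<Union>(basic_open L ` B)" using U(1) by (auto simp: B_def)
  qed
  then obtain F where F: "finite F" "F \<subseteq> B" "basic_open L a \<subseteq> \<Union>(basic_open L ` F)"
    using basic_open_finite_subcover[OF a _ cover] B by blast
  have "\<forall>b\<in>F. \<exists>U\<in>\<U>. basic_open L b \<subseteq> U" using F(2) by (auto simp: B_def)
  then obtain u where u: "\<forall>b\<in>F. u b \<in> \<U> \<and> basic_open L b \<subseteq> u b" by metis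
  then have "finite (u ` F)" "u ` F \<subseteq> \<U>" "basic_open L a \<subseteq> \<Union>(u ` F)" using F by blast+
  then show "\<exists>\<F>. finite \<F> \<and> \<F> \<subseteq> \<U> \<and> basic_open L a \<subseteq> \<Union>\<F>" by blast
qed

lemma compact_open_basic_open: "a \<in> carrier L \<Longrightarrow> compact_open (prime_spectrum L) (basic_open L a)"
  by (simp add: compact_open_def compactin_basic_open openin_basic_open)

lemma compact_open_prime_spectrumE:
  assumes W: "compact_open (prime_spectrum L) W" "W \<noteq> {}"
  obtains a where "a \<in> carrier L" "W = basic_open L a"
proof -
  define \<U> where "\<U> = {U \<in> basic_open L ` carrier L. U \<subseteq> W}"
  have "W \<subseteq> \<Union>\<U>"
    using W(1) unfolding compact_open_def openin_prime_spectrum_iff \<U>_def by blast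
  moreover have "\<forall>U\<in>\<U>. openin (prime_spectrum L) U" by (auto simp: \<U>_def openin_basic_open)
  ultimately obtain \<F> where \<F>: "finite \<F>" "\<F> \<subseteq> \<U>" "W \<subseteq> \<Union>\<F>"
    using W(1) unfolding compact_open_def compactin_def by metis
  have "\<exists>a\<in>carrier L. \<Union>\<F> = basic_open L a" if "finite \<F>" "\<F> \<noteq> {}" "\<F> \<subseteq> basic_open L ` carrier L" for \<F>
    using that
  proof (induction \<F> rule: finite_ne_induct)
    case (insert U \<F>)
    then obtain a b where "a \<in> carrier L" "b \<in> carrier L" "\<Union>\<F> = basic_open L a" "U = basic_open L b"
      by auto
    then have "\<Union>(insert U \<F>) = basic_open L (b \<squnion> a)" "b \<squnion> a \<in> carrier L"
      by (simp_all add: basic_open_join)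
    then show ?case by blast
  qed auto
  \<comment> \<open>Without a minimum there is no empty join. Non-emptiness of \<open>W\<close>
    makes the finite subfamily non-empty, so its union is the basic set of an iterated binary
    join.\<close>
  moreover have "\<F> \<noteq> {}" using \<F>(3) W(2) by blast
  moreover have "\<F> \<subseteq> basic_open L ` carrier L" "\<Union>\<F> = W" using \<F> unfolding \<U>_def by blast+
  ultimately show thesis using that \<F>(1) by metis
qed

text \<open>If the basic set is empty, \<open>a\<close> is a minimum. Non-empty compact open sets
  are basic, so the clause for the empty set becomes
  \<open>basic_open_finite_intersection\<close>.\<close>

lemma fundamental_basic_open:
  assumes a: "a \<in> carrier L"
  shows "fundamental (prime_spectrum L) (basic_open L a)"
proof (cases "basic_open L a = {}")
  case False
  then show ?thesis using compact_open_basic_open[OF a] by (simp add: fundamental_def)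
next
  case True
  have "\<exists>\<F>. finite \<F> \<and> \<F> \<noteq> {} \<and> \<F> \<subseteq> \<U> \<and> \<Inter>\<F> = {}"
    if \<U>: "\<U> \<noteq> {}" "\<And>U. U \<in> \<U> \<Longrightarrow> U \<noteq> {}"
      "\<And>U. U \<in> \<U> \<Longrightarrow> compact_open (prime_spectrum L) U" "\<Inter>\<U> = {}" for \<U>
  proof -
    define A where "A = {x \<in> carrier L. basic_open L x \<in> \<U>}"
    have \<U>A: "\<U> = basic_open L ` A"
    proof
      show "\<U> \<subseteq> basic_open L ` A"
      proof
        fix U assume U: "U \<in> \<U>"
        then obtain x where "x \<in> carrier L" "U = basic_open L x"
          using \<U>(2,3) compact_open_prime_spectrumE by metis
        then show "U \<in> basic_open L ` A" using U by (simp add: A_def)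
      qed
    qed (auto simp: A_def)
    have AL: "A \<subseteq> carrier L" by (auto simp: A_def)
    have Ane: "A \<noteq> {}" and AI: "\<Inter>(basic_open L ` A) = {}" using \<U>(1,4) \<U>A by simp_all
    obtain F where F: "finite F" "F \<noteq> {}" "F \<subseteq> A" "\<Inter>(basic_open L ` F) = {}"
      using basic_open_finite_intersection[OF least_if_basic_open_empty[OF a True] AL Ane AI] by blast
    show ?thesis
      by (rule exI[of _ "basic_open L ` F"]) (use F \<U>A in auto)
  qed
  then show ?thesis unfolding True by (rule fundamental_emptyI)
qed

text \<open>If no basic set is empty, the family of all of them is a test family for the clause on
  the empty set: a prime ideal in its intersection would have no elements. A finite subfamily then
  has empty intersection, yet that intersection is the basic set of a finite meet.\<close>

lemma fundamental_empty_basic_open: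
  assumes "fundamental (prime_spectrum L) {}"
  shows "\<exists>a\<in>carrier L. basic_open L a = {}"
proof (rule ccontr)
  assume neg: "\<not> ?thesis"
  have "\<Inter>(basic_open L ` carrier L) = {}"
  proof (rule ccontr)
    assume "\<not> ?thesis"
    then obtain P where P: "\<And>a. a \<in> carrier L \<Longrightarrow> P \<in> basic_open L a" by auto
    obtain b where "b \<in> carrier L" using nonempty by auto
    then have "prime_lattice_ideal L P" using P by (simp add: basic_open_def)
    then obtain a where "a \<in> P" "a \<in> carrier L"
      using prime_ideal_nonempty prime_ideal_subset by blast
    then show False using P by (simp add: basic_open_def)
  qed
  moreover have ne: "basic_open L ` carrier L \<noteq> {}" using nonempty by simp
  moreover have co: "U \<noteq> {} \<and> compact_open (prime_spectrum L) U" if "U \<in> basic_open L ` carrier L" for U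
    using that neg compact_open_basic_open by auto
  ultimately obtain \<F> where \<F>: "finite \<F>" "\<F> \<noteq> {}" "\<F> \<subseteq> basic_open L ` carrier L" "\<Inter>\<F> = {}"
    using fundamental_emptyD[OF assms, of "basic_open L ` carrier L"] ne co by metis
  have "\<exists>a\<in>carrier L. basic_open L a = \<Inter>\<F>"
    if "finite \<F>" "\<F> \<noteq> {}" "\<F> \<subseteq> basic_open L ` carrier L" for \<F>
    using that
  proof (induction \<F> rule: finite_ne_induct)
    case (insert U \<F>)
    then obtain a b where "a \<in> carrier L" "b \<in> carrier L" "basic_open L a = \<Inter>\<F>" "U = basic_open L b"
      by auto
    then have "basic_open L (b \<sqinter> a) = \<Inter>(insert U \<F>)" "b \<sqinter> a \<in> carrier L"
      by (simp_all add: basic_open_meet)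
    then show ?case by blast
  qed auto
  then show False using \<F> neg by metis
qed

lemma fundamental_prime_spectrum_eq:
  "{U. fundamental (prime_spectrum L) U} = basic_open L ` carrier L"
proof
  show "{U. fundamental (prime_spectrum L) U} \<subseteq> basic_open L ` carrier L"
  proof
    fix U assume "U \<in> {U. fundamental (prime_spectrum L) U}"
    then have U: "fundamental (prime_spectrum L) U" by simp
    show "U \<in> basic_open L ` carrier L"
    proof (cases "U = {}")
      case True
      then show ?thesis using fundamental_empty_basic_open U by blast
    next
      case False
      then have "compact_open (prime_spectrum L) U" using U by (simp add: fundamental_def)
      then show ?thesis using False by (auto elim: compact_open_prime_spectrumE)
    qed
  qed
qed (auto intro: fundamental_basic_open)

lemma coherent_prime_spectrum: "coherent (prime_spectrum L)"
proof -
  have "\<Inter>\<F> \<in> basic_open L ` carrier L"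
    if "finite \<F>" "\<F> \<noteq> {}" "\<F> \<subseteq> basic_open L ` carrier L" for \<F>
    using that
  proof (induction \<F> rule: finite_ne_induct)
    case (insert U \<F>)
    then show ?case by (auto simp flip: basic_open_meet)
  qed auto
  then show ?thesis
    unfolding coherent_def
    by (intro exI[of _ "basic_open L ` carrier L"])
       (auto simp: openin_prime_spectrum compact_open_basic_open)
qed

section \<open>Soberness, separation and compactness of the spectrum\<close>

lemma closure_of_singleton_prime_spectrum:
  assumes "prime_lattice_ideal L P"
  shows "prime_spectrum L closure_of {P} = {Q. prime_lattice_ideal L Q \<and> P \<subseteq> Q}"
proof -
  have "(\<forall>T. Q \<in> T \<and> openin (prime_spectrum L) T \<longrightarrow> P \<in> T) \<longleftrightarrow> P \<subseteq> Q"
    if Q: "prime_lattice_ideal L Q" for Q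
  proof
    assume R: "\<forall>T. Q \<in> T \<and> openin (prime_spectrum L) T \<longrightarrow> P \<in> T"
    show "P \<subseteq> Q"
    proof
      fix a assume a: "a \<in> P"
      then have aL: "a \<in> carrier L" using prime_ideal_subset[OF assms] by blast
      show "a \<in> Q"
        using R[rule_format, of "basic_open L a"] openin_basic_open[OF aL] a Q
        by (auto simp: basic_open_def)
    qed
  next
    assume PQ: "P \<subseteq> Q"
    show "\<forall>T. Q \<in> T \<and> openin (prime_spectrum L) T \<longrightarrow> P \<in> T"
    proof (intro allI impI)
      fix T assume T: "Q \<in> T \<and> openin (prime_spectrum L) T"
      then obtain a where "Q \<in> basic_open L a" "basic_open L a \<subseteq> T"
        using openin_prime_spectrum_iff by meson
      then show "P \<in> T" using PQ assms by (auto simp: basic_open_def)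
    qed
  qed
  then show ?thesis
    by (auto simp: closure_of_def topspace_prime_spectrum)
qed

text \<open>The generic point is the intersection of all members of \<open>C\<close>, written as the
  set \<open>P\<close> of elements whose basic set misses \<open>C\<close>. Irreducibility of
  \<open>C\<close> becomes primality of \<open>P\<close>.\<close>

lemma irreducible_closed_prime_spectrum:
  assumes C: "irreducible_closed (prime_spectrum L) C"
    and ne: "C \<noteq> topspace (prime_spectrum L) \<or> has_minimum L"
  obtains P where "prime_lattice_ideal L P" "C = prime_spectrum L closure_of {P}"
proof -
  define P where "P = {a \<in> carrier L. basic_open L a \<inter> C = {}}"
  have cl: "closedin (prime_spectrum L) C" and Cne: "C \<noteq> {}"
    using C by (auto simp: irreducible_closed_def)
  have Csub: "C \<subseteq> {Q. prime_lattice_ideal L Q}"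
    using closedin_subset[OF cl] by (simp add: topspace_prime_spectrum)
  have sep: "\<exists>a\<in>P. a \<notin> Q" if Q: "prime_lattice_ideal L Q" "Q \<notin> C" for Q
  proof -
    have "openin (prime_spectrum L) (topspace (prime_spectrum L) - C)" using cl by blast
    moreover have "Q \<in> topspace (prime_spectrum L) - C" using Q by (simp add: topspace_prime_spectrum)
    ultimately obtain a where "a \<in> carrier L" "Q \<in> basic_open L a"
        "basic_open L a \<subseteq> topspace (prime_spectrum L) - C"
      using openin_prime_spectrum_iff by meson
    then show ?thesis by (auto simp: P_def basic_open_def)
  qed
  \<comment> \<open>The hypothesis \<open>ne\<close> is used here: when \<open>C\<close> is the
    whole space, \<open>P\<close> consists of the minima of the lattice and may be empty.\<close>
  have Pne: "P \<noteq> {}"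
    using ne
  proof
    assume "C \<noteq> topspace (prime_spectrum L)"
    then show ?thesis using sep Csub by (auto simp: topspace_prime_spectrum)
  next
    assume "has_minimum L"
    then obtain z where z: "least L z (carrier L)" by (auto simp: has_minimum_def)
    then have "z \<in> P" using basic_open_least[OF z] by (auto simp: P_def least_def)
    then show ?thesis by blast
  qed
  have "prime_lattice_ideal L P"
    unfolding prime_lattice_ideal_iff
  proof (intro conjI ballI impI)
    show "P \<subseteq> carrier L" by (auto simp: P_def)
    show "P \<noteq> carrier L"
    proof -
      obtain Q where Q: "Q \<in> C" using Cne by blast
      then have "prime_lattice_ideal L Q" using Csub by blast
      then obtain a where "a \<in> carrier L" "a \<notin> Q" using prime_ideal_proper by blast
      then have "a \<notin> P" using Q \<open>prime_lattice_ideal L Q\<close> by (auto simp: P_def basic_open_def)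
      then show ?thesis using \<open>a \<in> carrier L\<close> by blast
    qed
    show "x \<in> P" if "x \<in> carrier L" "y \<in> P" "x \<sqsubseteq> y" for x y
    proof -
      have "basic_open L x \<subseteq> basic_open L y" using that by (simp add: P_def basic_open_subset_iff)
      then show ?thesis using that by (auto simp: P_def)
    qed
    show "x \<squnion> y \<in> P" if "x \<in> P" "y \<in> P" for x y
      using that by (auto simp: P_def basic_open_join)
    show "a \<in> P \<or> b \<in> P" if ab: "a \<in> carrier L" "b \<in> carrier L" "a \<sqinter> b \<in> P" for a b
    proof -
      \<comment> \<open>No point of \<open>C\<close> lies in both basic sets, so removing them one
        at a time leaves two closed sets that cover \<open>C\<close>.\<close>
      have "C = (C - basic_open L a) \<union> (C - basic_open L b)"
        using ab by (auto simp: P_def basic_open_meet)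
      then have "C - basic_open L a = C \<or> C - basic_open L b = C"
        using irreducible_closed_cases[OF C] cl ab(1,2) openin_basic_open closedin_diff by metis
      then show ?thesis using ab by (auto simp: P_def)
    qed
  qed (rule Pne)
  moreover have "C = {Q. prime_lattice_ideal L Q \<and> P \<subseteq> Q}"
  proof
    show "C \<subseteq> {Q. prime_lattice_ideal L Q \<and> P \<subseteq> Q}"
      using Csub by (auto simp: P_def basic_open_def)
    show "{Q. prime_lattice_ideal L Q \<and> P \<subseteq> Q} \<subseteq> C" using sep by blast
  qed
  ultimately show thesis using that closure_of_singleton_prime_spectrum by metis
qed

lemma almost_sober_prime_spectrum: "almost_sober (prime_spectrum L)"
  unfolding almost_sober_def
  by (metis irreducible_closed_prime_spectrum mem_Collect_eq topspace_prime_spectrum)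

lemma sober_prime_spectrum:
  assumes "has_minimum L"
  shows "sober (prime_spectrum L)"
  unfolding sober_def
proof (intro allI impI)
  fix C assume "irreducible_closed (prime_spectrum L) C"
  then obtain P where P: "prime_lattice_ideal L P" "C = prime_spectrum L closure_of {P}"
    using irreducible_closed_prime_spectrum assms by metis
  show "\<exists>!P. P \<in> topspace (prime_spectrum L) \<and> C = prime_spectrum L closure_of {P}"
  proof (rule ex1I[of _ P])
    fix Q assume "Q \<in> topspace (prime_spectrum L) \<and> C = prime_spectrum L closure_of {Q}"
    then have "prime_lattice_ideal L Q"
      "{Q. prime_lattice_ideal L Q \<and> P \<subseteq> Q} = {Q'. prime_lattice_ideal L Q' \<and> Q \<subseteq> Q'}"
      using P by (auto simp: topspace_prime_spectrum closure_of_singleton_prime_spectrum)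
    then show "Q = P" using P(1) by blast
  qed (use P in \<open>simp add: topspace_prime_spectrum\<close>)
qed

lemma t0_prime_spectrum: "t0_space (prime_spectrum L)"
  unfolding t0_space_def
proof (intro ballI impI)
  fix P Q assume "P \<in> topspace (prime_spectrum L)" "Q \<in> topspace (prime_spectrum L)" "P \<noteq> Q"
  then have PQ: "prime_lattice_ideal L P" "prime_lattice_ideal L Q" "P \<noteq> Q"
    by (auto simp: topspace_prime_spectrum)
  then obtain a where a: "a \<in> carrier L" "a \<in> P \<longleftrightarrow> a \<notin> Q"
    using prime_ideal_subset by blast
  then show "\<exists>U. openin (prime_spectrum L) U \<and> (P \<notin> U) = (Q \<in> U)"
    using PQ openin_basic_open[of a] by (intro exI[of _ "basic_open L a"]) (auto simp: basic_open_def)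
qed

text \<open>A prime ideal is a proper lower set and therefore omits the maximum \<open>t\<close>, so
  the whole spectrum is the single compact set \<open>basic_open L t\<close>.\<close>

lemma compact_space_prime_spectrum:
  assumes "has_maximum L"
  shows "compact_space (prime_spectrum L)"
proof -
  obtain t where t: "greatest L t (carrier L)" using assms by (auto simp: has_maximum_def)
  then have "topspace (prime_spectrum L) = basic_open L t"
    unfolding topspace_prime_spectrum basic_open_def greatest_def
    using prime_ideal_proper prime_ideal_downward by blast
  then show ?thesis
    using t compactin_basic_open[of t] by (simp add: compact_space_def greatest_def)
qed

end

section \<open>Coherent spaces\<close>

lemma fundamental_subset_topspace: "fundamental X A \<Longrightarrow> A \<subseteq> topspace X"
  by (auto simp: fundamental_def compact_open_def dest: openin_subset)

lemma sober_imp_almost_sober: "sober X \<Longrightarrow> almost_sober X"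
  unfolding sober_def almost_sober_def by blast

text \<open>A closed set through \<open>x\<close> contains the closure of \<open>x\<close>, so in
  any decomposition the part containing \<open>x\<close> is everything.\<close>

lemma irreducible_closed_closure_of_singleton:
  assumes "x \<in> topspace X"
  shows "irreducible_closed X (X closure_of {x})"
proof -
  have x: "x \<in> X closure_of {x}"
    using assms closure_of_subset[of "{x}" X] by simp
  have "A = X closure_of {x}" if "closedin X A" "A \<subseteq> X closure_of {x}" "x \<in> A" for A
    using that closure_of_minimal[of "{x}" A X] by auto
  then have "A = X closure_of {x} \<or> B = X closure_of {x}"
    if "closedin X A" "closedin X B" "X closure_of {x} = A \<union> B" for A B
    using that x by blast
  then have "\<not> (\<exists>A B. closedin X A \<and> closedin X B \<and> A \<subset> X closure_of {x} \<and>
      B \<subset> X closure_of {x} \<and> X closure_of {x} = A \<union> B)"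
    by (metis psubset_eq)
  then show ?thesis
    unfolding irreducible_closed_def using x by auto
qed

lemma sober_imp_t0_space:
  assumes "sober X"
  shows "t0_space X"
  unfolding t0_space_closure_of_sing
proof (intro ballI impI)
  fix x y assume "x \<in> topspace X" "y \<in> topspace X" "X closure_of {x} = X closure_of {y}"
  then show "x = y"
    using assms irreducible_closed_closure_of_singleton[of x X] unfolding sober_def by blast
qed

locale coherent_space =
  fixes X :: "'b topology"
  assumes coherent: "coherent X"
begin

text \<open>Coherence asserts only that a suitable basis exists; one is fixed here so that later
  arguments can refer to it.\<close>

definition base_sets :: "'b set set" where
  "base_sets = (SOME \<B>. openin X = arbitrary union_of (\<lambda>U. U \<in> \<B>) \<and>
       (\<forall>U\<in>\<B>. compact_open X U) \<and>
       (\<forall>\<F>. finite \<F> \<and> \<F> \<noteq> {} \<and> \<F> \<subseteq> \<B> \<longrightarrow> \<Inter>\<F> \<in> \<B>))"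

lemma base: "openin X = arbitrary union_of (\<lambda>U. U \<in> base_sets)" "\<forall>U\<in>base_sets. compact_open X U"
  "\<forall>\<F>. finite \<F> \<and> \<F> \<noteq> {} \<and> \<F> \<subseteq> base_sets \<longrightarrow> \<Inter>\<F> \<in> base_sets"
  using someI_ex[OF coherent[unfolded coherent_def], folded base_sets_def] by - (elim conjE, assumption)+

lemma compact_open_base:
  assumes "openin X W" "x \<in> W"
  obtains U where "U \<in> base_sets" "compact_open X U" "x \<in> U" "U \<subseteq> W"
proof -
  have "(arbitrary union_of (\<lambda>U. U \<in> base_sets)) W" using assms(1) base(1) by simp
  then obtain U where "U \<in> base_sets" "x \<in> U" "U \<subseteq> W"
    using assms(2) by (auto simp: arbitrary_union_of_alt)
  then show thesis using that base(2) by simp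
qed

lemma compact_open_finite_union:
  assumes "compact_open X U"
  obtains \<F> where "finite \<F>" "\<F> \<subseteq> base_sets" "U = \<Union>\<F>"
proof -
  have U: "openin X U" "compactin X U" using assms by (simp_all add: compact_open_def)
  have "\<exists>V\<in>base_sets. x \<in> V \<and> V \<subseteq> U" if "x \<in> U" for x
    by (rule compact_open_base[OF U(1) that]) auto
  then have "U \<subseteq> \<Union>{V \<in> base_sets. V \<subseteq> U}" by auto
  moreover have "openin X V" if "V \<in> {V \<in> base_sets. V \<subseteq> U}" for V
    using base(2) that by (simp add: compact_open_def)
  ultimately obtain \<F> where \<F>: "finite \<F>" "\<F> \<subseteq> {V \<in> base_sets. V \<subseteq> U}" "U \<subseteq> \<Union>\<F>"
    using compactinD[OF U(2)] by meson
  then have "U = \<Union>\<F>" "\<F> \<subseteq> base_sets" by auto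
  then show thesis by (rule that[OF \<F>(1), rotated])
qed

lemma compact_open_Un:
  "\<lbrakk>compact_open X U; compact_open X V\<rbrakk> \<Longrightarrow> compact_open X (U \<union> V)"
  by (auto simp: compact_open_def compactin_Un)

lemma compact_open_empty: "compact_open X {}"
  by (simp add: compact_open_def)

text \<open>Coherence gives closure under intersection for one basis only. Arbitrary compact open
  sets are finite unions of its members, and distributing the intersection over these unions leaves
  finitely many basis sets.\<close>

lemma compact_open_Int:
  assumes "compact_open X U" "compact_open X V"
  shows "compact_open X (U \<inter> V)"
proof -
  obtain \<F> where \<F>: "finite \<F>" "\<F> \<subseteq> base_sets" "U = \<Union>\<F>"
    using assms(1) by (rule compact_open_finite_union)
  obtain \<G> where \<G>: "finite \<G>" "\<G> \<subseteq> base_sets" "V = \<Union>\<G>"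
    using assms(2) by (rule compact_open_finite_union)
  have "A \<inter> B \<in> base_sets" if "A \<in> base_sets" "B \<in> base_sets" for A B
    using base(3)[rule_format, of "{A, B}"] that by simp
  then have "compactin X (A \<inter> B)" if "A \<in> \<F>" "B \<in> \<G>" for A B
    using that \<F>(2) \<G>(2) base(2) by (simp add: compact_open_def subset_iff)
  then have "compactin X (\<Union>((\<lambda>(A, B). A \<inter> B) ` (\<F> \<times> \<G>)))"
    using \<F>(1) \<G>(1) by (intro compactin_Union) auto
  moreover have "U \<inter> V = \<Union>((\<lambda>(A, B). A \<inter> B) ` (\<F> \<times> \<G>))"
    using \<F>(3) \<G>(3) by auto
  ultimately have "compactin X (U \<inter> V)" by simp
  then show ?thesis
    using assms by (simp add: compact_open_def openin_Int)
qed

lemma fundamental_nonempty_iff: "U \<noteq> {} \<Longrightarrow> fundamental X U \<longleftrightarrow> compact_open X U"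
  by (simp add: fundamental_def)

lemma fundamental_compact_open: "fundamental X U \<Longrightarrow> compact_open X U"
  using compact_open_empty by (auto simp: fundamental_def)

text \<open>A compact open set around a point is non-empty, so the condition on the empty set does
  not arise.\<close>

lemma fundamental_base:
  assumes "openin X W" "x \<in> W"
  obtains U where "fundamental X U" "x \<in> U" "U \<subseteq> W"
proof -
  obtain U where "compact_open X U" "x \<in> U" "U \<subseteq> W"
    using assms by (rule compact_open_base)
  then show thesis using that[of U] by (auto simp: fundamental_def)
qed

lemma fundamental_Un:
  assumes "fundamental X U" "fundamental X V"
  shows "fundamental X (U \<union> V)"
proof (cases "U \<union> V = {}")
  case True
  then show ?thesis using assms by simp
next
  case False
  then show ?thesis
    using assms by (simp add: fundamental_nonempty_iff fundamental_compact_open compact_open_Un)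
qed

text \<open>Needed for the dual lattice to be non-empty. In the empty space the empty set is
  fundamental for lack of non-empty open sets.\<close>

lemma fundamental_exists: "\<exists>U. fundamental X U"
proof (cases "topspace X = {}")
  case True
  have "fundamental X {}"
  proof (rule fundamental_emptyI)
    fix \<U> :: "'b set set" assume "\<U> \<noteq> {}" and \<U>: "\<And>U. U \<in> \<U> \<Longrightarrow> U \<noteq> {}" "\<And>U. U \<in> \<U> \<Longrightarrow> compact_open X U"
    then obtain U where "U \<in> \<U>" by blast
    then have "U \<noteq> {}" "openin X U"
      using \<U> by (simp_all add: compact_open_def)
    then have "topspace X \<noteq> {}" using openin_subset by blast
    then show "\<exists>\<F>. finite \<F> \<and> \<F> \<noteq> {} \<and> \<F> \<subseteq> \<U> \<and> \<Inter>\<F> = {}" using True by simp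
  qed
  then show ?thesis by blast
next
  case False
  then show ?thesis by (metis ex_in_conv fundamental_base openin_topspace)
qed

text \<open>The condition on the empty set holds vacuously: \<open>x\<close> lies in every
  intersection of non-empty open sets.\<close>

lemma fundamental_empty_if_generic_point:
  assumes "x \<in> topspace X" "\<And>W. \<lbrakk>openin X W; W \<noteq> {}\<rbrakk> \<Longrightarrow> x \<in> W"
  shows "fundamental X {}"
proof (rule fundamental_emptyI)
  fix \<U> :: "'b set set"
  assume \<U>: "\<And>U. U \<in> \<U> \<Longrightarrow> U \<noteq> {}" "\<And>U. U \<in> \<U> \<Longrightarrow> compact_open X U" "\<Inter>\<U> = {}"
  have "x \<in> \<Inter>\<U>" using assms(2) \<U>(1,2) by (auto simp: compact_open_def)
  then show "\<exists>\<F>. finite \<F> \<and> \<F> \<noteq> {} \<and> \<F> \<subseteq> \<U> \<and> \<Inter>\<F> = {}" using \<U>(3) by simp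
qed

text \<open>The delicate clause is non-emptiness: some fundamental set must miss \<open>x\<close>.
  If a non-empty open set misses \<open>x\<close>, a fundamental set inside it does; otherwise
  \<open>x\<close> is generic and the empty set is fundamental.\<close>

lemma prime_set_ideal_of_point:
  assumes x: "x \<in> topspace X"
  shows "prime_set_ideal {U. fundamental X U} {U. fundamental X U \<and> x \<notin> U}"
proof -
  obtain U where U: "fundamental X U" "x \<in> U"
    using x by (metis fundamental_base openin_topspace)
  have "\<exists>V. fundamental X V \<and> x \<notin> V"
  proof (cases "\<exists>W. openin X W \<and> W \<noteq> {} \<and> x \<notin> W")
    case True
    then obtain W y where "openin X W" "y \<in> W" "x \<notin> W" by blast
    then show ?thesis by (metis fundamental_base subsetD)
  next
    case False
    then have "fundamental X {}" using fundamental_empty_if_generic_point[OF x] by blast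
    then show ?thesis by blast
  qed
  then show ?thesis
    unfolding prime_set_ideal_def using U by (auto simp: fundamental_Un)
qed

end

text \<open>A bound in \<open>Q\<close> is claimed, not membership of the union, because
  \<open>\<F>\<close> may be empty and the empty set need not belong to \<open>Q\<close>.\<close>

lemma prime_set_ideal_finite_Union:
  assumes Q: "prime_set_ideal \<S> Q" and "finite \<F>" "\<F> \<subseteq> Q"
  shows "\<exists>V\<in>Q. \<Union>\<F> \<subseteq> V"
  using assms(2,3)
proof (induction \<F> rule: finite_induct)
  case empty
  then show ?case using Q by (auto simp: prime_set_ideal_def)
next
  case (insert U \<F>)
  then obtain V where V: "V \<in> Q" "\<Union>\<F> \<subseteq> V" "U \<in> Q" by auto
  then have "U \<union> V \<in> Q" using Q by (simp add: prime_set_ideal_def)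
  moreover have "\<Union>(insert U \<F>) \<subseteq> U \<union> V" using V by auto
  ultimately show ?case by blast
qed

lemma prime_set_ideal_finite_Inter:
  assumes Q: "prime_set_ideal \<S> Q" and Int: "\<And>U V. \<lbrakk>U \<in> \<S>; V \<in> \<S>\<rbrakk> \<Longrightarrow> U \<inter> V \<in> \<S>"
    and "finite \<F>" "\<F> \<noteq> {}" "\<F> \<subseteq> \<S> - Q"
  shows "\<Inter>\<F> \<in> \<S> - Q"
  using assms(3-5)
proof (induction \<F> rule: finite_ne_induct)
  case (insert U \<F>)
  then have U: "U \<in> \<S>" "U \<notin> Q" and F: "\<Inter>\<F> \<in> \<S>" "\<Inter>\<F> \<notin> Q" by auto
  have "\<forall>U\<in>\<S>. \<forall>V\<in>\<S>. U \<inter> V \<in> Q \<longrightarrow> U \<in> Q \<or> V \<in> Q"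
    using Q by (simp add: prime_set_ideal_def)
  then have "U \<inter> \<Inter>\<F> \<notin> Q" using U F by blast
  then show ?case using Int[OF U(1) F(1)] by simp
qed auto

section \<open>Points determined by prime ideals of open sets\<close>

context coherent_space
begin

text \<open>The complement of the union of a prime ideal of basic open sets is an irreducible closed
  set; its generic point is the point that determines the ideal.\<close>

lemma point_of_prime_set_ideal:
  assumes comp: "\<And>U. U \<in> \<S> \<Longrightarrow> compact_open X U"
    and basis: "\<And>W x. \<lbrakk>openin X W; x \<in> W\<rbrakk> \<Longrightarrow> \<exists>U\<in>\<S>. x \<in> U \<and> U \<subseteq> W"
    and Int: "\<And>U V. \<lbrakk>U \<in> \<S>; V \<in> \<S>\<rbrakk> \<Longrightarrow> U \<inter> V \<in> \<S>"
    and Q: "prime_set_ideal \<S> Q" and sob: "sober X \<or> almost_sober X \<and> \<Union>Q \<noteq> {}"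
  obtains x where "x \<in> topspace X" "Q = {U \<in> \<S>. x \<notin> U}"
proof -
  define C where "C = topspace X - \<Union>Q"
  have QS: "Q \<subseteq> \<S>" "Q \<noteq> {}" "Q \<noteq> \<S>" using Q by (auto simp: prime_set_ideal_def)
  have Qdown: "U \<in> Q" if "U \<in> \<S>" "V \<in> Q" "U \<subseteq> V" for U V
    using Q that unfolding prime_set_ideal_def by blast
  have Qprime: "U \<in> Q \<or> V \<in> Q" if "U \<in> \<S>" "V \<in> \<S>" "U \<inter> V \<in> Q" for U V
    using Q that unfolding prime_set_ideal_def by blast
  have Qopen: "openin X U" if "U \<in> \<S>" for U using comp[OF that] by (simp add: compact_open_def)
  \<comment> \<open>By compactness \<open>Q\<close> is recovered from its union: it contains every
    member of \<open>\<S>\<close> that lies inside \<open>\<Union>Q\<close>.\<close>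
  have mem: "U \<in> Q" if U: "U \<in> \<S>" "U \<subseteq> \<Union>Q" for U
  proof -
    have "compactin X U" using comp U by (simp add: compact_open_def)
    moreover have "\<And>V. V \<in> Q \<Longrightarrow> openin X V" using QS(1) Qopen by blast
    ultimately obtain \<F> where "finite \<F>" "\<F> \<subseteq> Q" "U \<subseteq> \<Union>\<F>"
      using U(2) compactinD[of X U Q] by blast
    then obtain V where "V \<in> Q" "U \<subseteq> V" using prime_set_ideal_finite_Union[OF Q] by (meson order_trans)
    then show ?thesis using Qdown U(1) by blast
  qed
  have sub: "U \<subseteq> topspace X" if "U \<in> \<S>" for U using Qopen[OF that] by (rule openin_subset)
  have clC: "closedin X C" unfolding C_def using QS(1) Qopen by blast
  have "irreducible_closed X C"
    unfolding irreducible_closed_def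
  proof (intro conjI notI)
    assume "C = {}"
    moreover obtain U where U: "U \<in> \<S>" "U \<notin> Q" using QS(1,3) by blast
    ultimately have "U \<subseteq> \<Union>Q" using sub by (auto simp: C_def)
    then show False using mem U by blast
  next
    assume "\<exists>A B. closedin X A \<and> closedin X B \<and> A \<subset> C \<and> B \<subset> C \<and> C = A \<union> B"
    then obtain A B x y where AB: "closedin X A" "closedin X B" "C = A \<union> B"
      and xy: "x \<in> C" "x \<notin> A" "y \<in> C" "y \<notin> B" by blast
    have "x \<in> topspace X - A" "y \<in> topspace X - B" using xy by (auto simp: C_def)
    moreover have "openin X (topspace X - A)" "openin X (topspace X - B)" using AB by auto
    ultimately obtain U V where U: "U \<in> \<S>" "x \<in> U" "U \<subseteq> topspace X - A"
      and V: "V \<in> \<S>" "y \<in> V" "V \<subseteq> topspace X - B" using basis by meson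
    \<comment> \<open>A point of \<open>U \<inter> V\<close> is in neither \<open>A\<close> nor
      \<open>B\<close>, hence not in \<open>C\<close>. Primality then puts \<open>U\<close> or
      \<open>V\<close> into \<open>Q\<close>, although each contains a point of
      \<open>C\<close>.\<close>
    have "U \<inter> V \<subseteq> \<Union>Q" using U(3) V(3) AB(3) by (auto simp: C_def)
    then have "U \<in> Q \<or> V \<in> Q" using mem Int Qprime U(1) V(1) by blast
    then show False using U(2) V(2) xy by (auto simp: C_def)
  qed (rule clC)
  \<comment> \<open>Almost-soberness says nothing about the whole space, and \<open>C\<close> is the
    whole space exactly when \<open>\<Union>Q\<close> is empty.\<close>
  moreover have "sober X \<or> C \<noteq> topspace X"
  proof (cases "\<Union>Q = {}")
    case False
    then have "\<Union>Q \<inter> topspace X \<noteq> {}" using QS(1) sub by blast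
    then show ?thesis by (auto simp: C_def)
  qed (use sob in blast)
  ultimately obtain x where x: "x \<in> topspace X" "C = X closure_of {x}"
    using sob unfolding sober_def almost_sober_def by blast
  have xC: "x \<in> C" unfolding x(2) using x(1) closure_of_subset[of "{x}" X] by simp
  have "U \<in> Q \<longleftrightarrow> x \<notin> U" if U: "U \<in> \<S>" for U
  proof
    assume "U \<in> Q" then show "x \<notin> U" using xC by (auto simp: C_def)
  next
    assume "x \<notin> U"
    then have "X closure_of {x} \<subseteq> topspace X - U"
      using x(1) Qopen[OF U] by (intro closure_of_minimal) auto
    then have "U \<subseteq> \<Union>Q" using x(2) sub[OF U] by (auto simp: C_def)
    then show "U \<in> Q" using mem U by blast
  qed
  then have "Q = {U \<in> \<S>. x \<notin> U}" using QS(1) by blast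
  then show thesis using that x(1) by blast
qed

text \<open>If no finite subfamily of \<open>\<U>\<close> has empty intersection, its finite
  intersections form a meet-closed family \<open>G\<close> without the empty set. A prime ideal of
  compact open sets that avoids \<open>G\<close> is the ideal of a point, and this point lies in
  every member of \<open>\<U>\<close>.\<close>

lemma fundamental_emptyI_sober:
  assumes sob: "sober X \<or>
    almost_sober X \<and> (\<exists>A B. compact_open X A \<and> compact_open X B \<and> A \<noteq> {} \<and> B \<noteq> {} \<and> A \<inter> B = {})"
  shows "fundamental X {}"
proof (rule fundamental_emptyI, rule ccontr)
  fix \<U> :: "'b set set"
  assume ne: "\<U> \<noteq> {}" and \<U>: "\<And>U. U \<in> \<U> \<Longrightarrow> U \<noteq> {}" "\<And>U. U \<in> \<U> \<Longrightarrow> compact_open X U"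
    and Inter: "\<Inter>\<U> = {}"
    and fip: "\<not> (\<exists>\<F>. finite \<F> \<and> \<F> \<noteq> {} \<and> \<F> \<subseteq> \<U> \<and> \<Inter>\<F> = {})"
  let ?K = "{U. compact_open X U}" and ?L = "set_lattice id {U. compact_open X U}"
  \<comment> \<open>The lattice is auxiliary, so the identity serves as encoding. All compact open
    sets are taken since they include the empty set and are already known to be closed under
    intersection.\<close>
  interpret K: encoded_set_lattice id ?K
    using compact_open_empty by unfold_locales (auto simp: compact_open_Un compact_open_Int)
  define G where "G = {\<Inter>\<F> | \<F>. finite \<F> \<and> \<F> \<noteq> {} \<and> \<F> \<subseteq> \<U>}"
  have mem_G: "\<Inter>\<F> \<in> G" if "finite \<F>" "\<F> \<noteq> {}" "\<F> \<subseteq> \<U>" for \<F>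
    unfolding G_def using that by blast
  have GK: "G \<subseteq> ?K"
  proof -
    have "compact_open X (\<Inter>\<F>)" if "finite \<F>" "\<F> \<noteq> {}" "\<F> \<subseteq> \<U>" for \<F>
      using that
      by (induction \<F> rule: finite_ne_induct) (auto simp: \<U>(2) intro: compact_open_Int)
    then show ?thesis by (auto simp: G_def)
  qed
  have \<U>G: "\<U> \<subseteq> G"
  proof
    fix U assume "U \<in> \<U>"
    then show "U \<in> G" using mem_G[of "{U}"] by simp
  qed
  have GInt: "U \<inter> V \<in> G" if UV: "U \<in> G" "V \<in> G" for U V
  proof -
    obtain \<F> \<H> where FH: "finite \<F>" "\<F> \<noteq> {}" "\<F> \<subseteq> \<U>" "U = \<Inter>\<F>"
      "finite \<H>" "\<H> \<noteq> {}" "\<H> \<subseteq> \<U>" "V = \<Inter>\<H>" using UV by (auto simp: G_def)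
    then show ?thesis using mem_G[of "\<F> \<union> \<H>"] by (simp add: Inter_Un_distrib)
  qed
  have le: "x \<sqsubseteq>\<^bsub>?L\<^esub> y \<longleftrightarrow> x \<subseteq> y" if "x \<in> ?K" "y \<in> ?K" for x y
    using K.le_iff[OF that] by simp
  have meet: "x \<sqinter>\<^bsub>?L\<^esub> y = x \<inter> y" if "x \<in> ?K" "y \<in> ?K" for x y
    using K.meet_eq[OF that] by simp
  have "lattice_ideal ?L {x \<in> carrier ?L. x \<sqsubseteq>\<^bsub>?L\<^esub> {}}"
    by (rule K.principal_ideal) (simp add: compact_open_empty)
  then obtain P where P: "prime_lattice_ideal ?L P" "{x \<in> carrier ?L. x \<sqsubseteq>\<^bsub>?L\<^esub> {}} \<subseteq> P" "P \<inter> G = {}"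
  proof (rule K.prime_ideal_separation)
    show "G \<subseteq> carrier ?L" using GK by simp
    show "G \<noteq> {}" using ne \<U>G by blast
    show "x \<sqinter>\<^bsub>?L\<^esub> y \<in> G" if "x \<in> G" "y \<in> G" for x y
    proof -
      have xy: "x \<in> ?K" "y \<in> ?K" using that GK by blast+
      show ?thesis unfolding meet[OF xy] using that by (rule GInt)
    qed
    show "{x \<in> carrier ?L. x \<sqsubseteq>\<^bsub>?L\<^esub> {}} \<inter> G = {}"
    proof (rule ccontr)
      assume "\<not> ?thesis"
      then have "{} \<in> G" using le compact_open_empty by auto
      then show False using fip by (auto simp: G_def)
    qed
  qed
  have Q: "prime_set_ideal ?K P"
    using K.prime_ideal_decode[OF P(1)] by auto
  have "{} \<in> P" using P(2) le compact_open_empty by auto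
  have sob': "sober X \<or> almost_sober X \<and> \<Union>P \<noteq> {}"
    using sob
  proof (elim disjE conjE exE)
    fix A B assume AB: "compact_open X A" "compact_open X B" "A \<noteq> {}" "B \<noteq> {}" "A \<inter> B = {}"
      and "almost_sober X"
    \<comment> \<open>The intersection is empty and thus in the prime ideal \<open>P\<close>. So
      \<open>P\<close> has a non-empty member, which is what \<open>point_of_prime_set_ideal\<close>
      requires in the almost-sober case.\<close>
    have "A \<in> P \<or> B \<in> P"
      using Q AB \<open>{} \<in> P\<close> unfolding prime_set_ideal_def by (metis mem_Collect_eq)
    then show ?thesis using AB \<open>almost_sober X\<close> by blast
  qed simp
  have basis: "\<exists>U\<in>?K. x \<in> U \<and> U \<subseteq> W" if "openin X W" "x \<in> W" for W x
    by (rule compact_open_base[OF that]) auto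
  obtain x where x: "x \<in> topspace X" "P = {U \<in> ?K. x \<notin> U}"
    by (rule point_of_prime_set_ideal[OF _ basis _ Q sob']) (auto simp: compact_open_Int)
  have "x \<in> U" if "U \<in> \<U>" for U
    using that x(2) P(3) \<U>(2) \<U>G by blast
  then show False using Inter by blast
qed

end

text \<open>These turn out to be exactly the Balbes-Dwinger spaces.\<close>

locale almost_spectral_space = coherent_space +
  assumes almost_sober: "almost_sober X" and t0: "t0_space X"
begin

text \<open>Only disjoint non-empty sets are a problem. They are themselves the two witnesses with
  which almost-soberness makes the empty set fundamental.\<close>

lemma fundamental_Int:
  assumes "fundamental X U" "fundamental X V"
  shows "fundamental X (U \<inter> V)"
proof (cases "U \<inter> V = {}")
  case False
  then show ?thesis
    using assms by (simp add: fundamental_nonempty_iff fundamental_compact_open compact_open_Int)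
next
  case True
  show ?thesis
  proof (cases "U = {} \<or> V = {}")
    case True
    then show ?thesis using assms by auto
  next
    case False
    then have "fundamental X {}"
      using assms fundamental_compact_open True almost_sober by (intro fundamental_emptyI_sober) blast
    then show ?thesis using True by simp
  qed
qed

lemma encoded_fundamental: "inj_on e {U. fundamental X U} \<Longrightarrow> encoded_set_lattice e {U. fundamental X U}"
  using fundamental_exists by unfold_locales (auto simp: fundamental_Un fundamental_Int)

lemma point_of_fundamental_ideal:
  assumes Q: "prime_set_ideal {U. fundamental X U} Q"
  obtains x where "x \<in> topspace X" "Q = {U. fundamental X U \<and> x \<notin> U}"
proof (cases "\<Union>Q = {}")
  case False
  then have sob: "sober X \<or> almost_sober X \<and> \<Union>Q \<noteq> {}" using almost_sober by blast
  have basis: "\<exists>U\<in>{U. fundamental X U}. x \<in> U \<and> U \<subseteq> W" if "openin X W" "x \<in> W" for W x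
    by (rule fundamental_base[OF that]) auto
  obtain x where "x \<in> topspace X" "Q = {U \<in> {U. fundamental X U}. x \<notin> U}"
    by (rule point_of_prime_set_ideal[OF _ basis _ Q sob])
       (auto simp: fundamental_Int fundamental_compact_open)
  then show thesis using that by simp
next
  case True
  have QS: "Q \<subseteq> {U. fundamental X U}" "Q \<noteq> {}" "Q \<noteq> {U. fundamental X U}"
    using Q by (auto simp: prime_set_ideal_def)
  have Qe: "Q = {{}}" using True QS(2) by auto
  define \<U> where "\<U> = {U. fundamental X U} - Q"
  have emp: "fundamental X {}" using QS(1) Qe by simp
  have ne: "\<U> \<noteq> {}" using QS by (auto simp: \<U>_def)
  have co: "U \<noteq> {} \<and> compact_open X U" if "U \<in> \<U>" for U
    using that by (auto simp: \<U>_def Qe fundamental_compact_open)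
  \<comment> \<open>Primality keeps finite intersections of sets outside \<open>Q\<close> outside
    \<open>Q\<close>, hence non-empty here. Fundamentality of the empty set upgrades this to a point
    common to all of them.\<close>
  have "\<Inter>\<U> \<noteq> {}"
  proof
    assume "\<Inter>\<U> = {}"
    then obtain \<F> where \<F>: "finite \<F>" "\<F> \<noteq> {}" "\<F> \<subseteq> \<U>" "\<Inter>\<F> = {}"
      using fundamental_emptyD[OF emp ne co] by blast
    then have "\<Inter>\<F> \<in> {U. fundamental X U} - Q"
      unfolding \<U>_def by (intro prime_set_ideal_finite_Inter[OF Q]) (auto simp: fundamental_Int)
    then show False using \<F>(4) Qe by simp
  qed
  then obtain x where x: "x \<in> \<Inter>\<U>" by blast
  then have "x \<in> topspace X"
    using ne fundamental_subset_topspace by (auto simp: \<U>_def)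
  moreover have "Q = {U. fundamental X U \<and> x \<notin> U}"
    using x QS(1) by (auto simp: \<U>_def Qe)
  ultimately show thesis by (rule that)
qed

lemma fundamental_separation:
  assumes "x \<in> topspace X" "y \<in> topspace X"
    and "\<And>U. fundamental X U \<Longrightarrow> x \<in> U \<longleftrightarrow> y \<in> U"
  shows "x = y"
proof (rule ccontr)
  assume "x \<noteq> y"
  then obtain W where "openin X W" "x \<notin> W \<longleftrightarrow> y \<in> W"
    using t0 assms(1,2) unfolding t0_space_def by blast
  then show False using assms(3) fundamental_base by (metis subsetD)
qed

end

text \<open>Continuity comes for free: fundamental sets form a basis of \<open>Y\<close>, and their
  inverse images, being fundamental, are open in \<open>X\<close>.\<close>

lemma strongly_continuousI:
  assumes "coherent Y" "f \<in> topspace X \<rightarrow>\<^sub>E topspace Y"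
    and pre: "\<And>A. fundamental Y A \<Longrightarrow> fundamental X {x \<in> topspace X. f x \<in> A}"
    and "coherent X"
  shows "f \<in> strongly_continuous_maps X Y"
proof -
  interpret X: coherent_space X by unfold_locales fact
  interpret Y: coherent_space Y by unfold_locales fact
  have "openin X {x \<in> topspace X. f x \<in> W}" if W: "openin Y W" for W
  proof (subst openin_subopen, intro ballI)
    fix x assume x: "x \<in> {x \<in> topspace X. f x \<in> W}"
    then obtain A where A: "fundamental Y A" "f x \<in> A" "A \<subseteq> W"
      using Y.fundamental_base[OF W] by auto
    then have "openin X {x \<in> topspace X. f x \<in> A}"
      using pre X.fundamental_compact_open by (auto simp: compact_open_def)
    then show "\<exists>T. openin X T \<and> x \<in> T \<and> T \<subseteq> {x \<in> topspace X. f x \<in> W}"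
      using x A by (intro exI[of _ "{x \<in> topspace X. f x \<in> A}"]) auto
  qed
  then show ?thesis
    using assms(2) pre unfolding strongly_continuous_maps_def continuous_map_def
    by (auto simp: PiE_def)
qed

section \<open>Stone duality\<close>

abbreviation fundamentals :: "'b topology \<Rightarrow> 'b set set" where
  "fundamentals X \<equiv> {U. fundamental X U}"

section \<open>Morphisms and the categories they form\<close>

lemma proper_homs_PiE: "f \<in> proper_homs L M \<Longrightarrow> f \<in> carrier L \<rightarrow>\<^sub>E carrier M"
  by (simp add: proper_homs_def lattice_homs_def)

lemma proper_homs_mem: "\<lbrakk>f \<in> proper_homs L M; x \<in> carrier L\<rbrakk> \<Longrightarrow> f x \<in> carrier M"
  using proper_homs_PiE by (rule PiE_mem)

lemma proper_homs_vimage: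
  "\<lbrakk>f \<in> proper_homs L M; prime_lattice_ideal M P\<rbrakk> \<Longrightarrow>
    prime_lattice_ideal L {x \<in> carrier L. f x \<in> P}"
  by (simp add: proper_homs_def)

lemma id_proper_homs:
  assumes "distributive_lattice L"
  shows "restrict (\<lambda>x. x) (carrier L) \<in> proper_homs L L"
  using assms by (intro order_isomorphism_proper) (auto simp: bij_betw_def inj_on_def)

lemma compose_proper_homs:
  assumes f: "f \<in> proper_homs L M" and g: "g \<in> proper_homs M N"
    and L: "distributive_lattice L"
  shows "compose (carrier L) g f \<in> proper_homs L N"
proof -
  interpret L: distr_lattice L using L by (simp add: distributive_lattice_iff)
  have fx: "f x \<in> carrier M" if "x \<in> carrier L" for x using proper_homs_mem f that .
  have gx: "g x \<in> carrier N" if "x \<in> carrier M" for x using proper_homs_mem g that .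
  have "compose (carrier L) g f \<in> lattice_homs L N"
    using f g unfolding proper_homs_def lattice_homs_def
    by (auto simp: compose_def fx gx)
  moreover have "prime_lattice_ideal L {x \<in> carrier L. compose (carrier L) g f x \<in> P}"
    if P: "prime_lattice_ideal N P" for P
  proof -
    have "{x \<in> carrier L. compose (carrier L) g f x \<in> P} =
        {x \<in> carrier L. f x \<in> {y \<in> carrier M. g y \<in> P}}"
      by (auto simp: compose_def fx)
    then show ?thesis using proper_homs_vimage[OF f proper_homs_vimage[OF g P]] by simp
  qed
  ultimately show ?thesis by (simp add: proper_homs_def)
qed

lemma strongly_continuous_maps_PiE:
  "f \<in> strongly_continuous_maps X Y \<Longrightarrow> f \<in> topspace X \<rightarrow>\<^sub>E topspace Y"
  by (auto simp: strongly_continuous_maps_def PiE_def continuous_map_def)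

lemma strongly_continuous_maps_mem:
  "\<lbrakk>f \<in> strongly_continuous_maps X Y; x \<in> topspace X\<rbrakk> \<Longrightarrow> f x \<in> topspace Y"
  using strongly_continuous_maps_PiE by (rule PiE_mem)

lemma strongly_continuous_maps_vimage:
  "\<lbrakk>f \<in> strongly_continuous_maps X Y; fundamental Y A\<rbrakk> \<Longrightarrow>
    fundamental X {x \<in> topspace X. f x \<in> A}"
  by (simp add: strongly_continuous_maps_def)

lemma id_strongly_continuous: "restrict (\<lambda>x. x) (topspace X) \<in> strongly_continuous_maps X X"
proof -
  have "{x \<in> topspace X. restrict (\<lambda>x. x) (topspace X) x \<in> A} = A" if "fundamental X A" for A
    using fundamental_subset_topspace[OF that] by auto
  moreover have "continuous_map X X (restrict (\<lambda>x. x) (topspace X))"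
    by (rule continuous_map_eq[OF continuous_map_id]) simp
  ultimately show ?thesis by (simp add: strongly_continuous_maps_def)
qed

lemma compose_strongly_continuous:
  assumes f: "f \<in> strongly_continuous_maps X Y" and g: "g \<in> strongly_continuous_maps Y Z"
  shows "compose (topspace X) g f \<in> strongly_continuous_maps X Z"
proof -
  have fx: "f x \<in> topspace Y" if "x \<in> topspace X" for x using strongly_continuous_maps_mem f that .
  have "continuous_map X Z (g \<circ> f)"
    using f g continuous_map_compose by (auto simp: strongly_continuous_maps_def)
  then have "continuous_map X Z (compose (topspace X) g f)"
    by (rule continuous_map_eq) (simp add: compose_def)
  moreover have "fundamental X {x \<in> topspace X. compose (topspace X) g f x \<in> A}"
    if A: "fundamental Z A" for A
  proof -
    have "{x \<in> topspace X. compose (topspace X) g f x \<in> A} =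
        {x \<in> topspace X. f x \<in> {y \<in> topspace Y. g y \<in> A}}"
      by (auto simp: compose_def fx)
    then show ?thesis
      using strongly_continuous_maps_vimage[OF f strongly_continuous_maps_vimage[OF g A]] by simp
  qed
  ultimately show ?thesis by (simp add: strongly_continuous_maps_def)
qed

lemma category_lattice_category: "is_category (lattice_category small P)"
  unfolding is_category_def lattice_category_def category.simps
proof (intro conjI ballI; (elim CollectE conjE)?)
  show "compose (carrier L) f (restrict (\<lambda>x. x) (carrier L)) = f"
    if "f \<in> proper_homs L M" for L M f
    using proper_homs_PiE[OF that] by (auto simp: PiE_def intro: compose_Id)
  show "compose (carrier L) (restrict (\<lambda>x. x) (carrier M)) f = f"
    if "f \<in> proper_homs L M" for L M f
    using proper_homs_PiE[OF that] by (auto simp: PiE_def intro: Id_compose)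
  show "compose (carrier K) h (compose (carrier K) g f) =
      compose (carrier K) (compose (carrier L) h g) f"
    if "f \<in> proper_homs K L" for f g h K L
    using proper_homs_PiE[OF that] by (auto simp: PiE_def intro: compose_assoc)
qed (simp_all add: id_proper_homs compose_proper_homs)

lemma category_space_category: "is_category (space_category small P)"
  unfolding is_category_def space_category_def category.simps
proof (intro conjI ballI; (elim CollectE conjE)?)
  show "compose (topspace X) f (restrict (\<lambda>x. x) (topspace X)) = f"
    if "f \<in> strongly_continuous_maps X Y" for X Y f
    using strongly_continuous_maps_PiE[OF that] by (auto simp: PiE_def intro: compose_Id)
  show "compose (topspace X) (restrict (\<lambda>x. x) (topspace Y)) f = f"
    if "f \<in> strongly_continuous_maps X Y" for X Y f
    using strongly_continuous_maps_PiE[OF that] by (auto simp: PiE_def intro: Id_compose)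
  show "compose (topspace W) h (compose (topspace W) g f) =
      compose (topspace W) (compose (topspace X) h g) f"
    if "f \<in> strongly_continuous_maps W X" for f g h W X
    using strongly_continuous_maps_PiE[OF that] by (auto simp: PiE_def intro: compose_assoc)
qed (simp_all add: id_strongly_continuous compose_strongly_continuous)

lemma category_opposite: "is_category C \<Longrightarrow> is_category (opposite C)"
  unfolding is_category_def opposite_def category.simps by simp

lemma isomorphism_lattice_category:
  assumes L: "distributive_lattice L" and M: "distributive_lattice M"
    and ext: "h \<in> carrier L \<rightarrow>\<^sub>E carrier M" and bij: "bij_betw h (carrier L) (carrier M)"
    and le: "\<And>x y. \<lbrakk>x \<in> carrier L; y \<in> carrier L\<rbrakk> \<Longrightarrow> h x \<sqsubseteq>\<^bsub>M\<^esub> h y \<longleftrightarrow> x \<sqsubseteq>\<^bsub>L\<^esub> y"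
  shows "is_isomorphism (lattice_category small P) L M h"
proof -
  define g where "g = restrict (inv_into (carrier L) h) (carrier M)"
  have gc: "g y \<in> carrier L" and hg: "h (g y) = y" if "y \<in> carrier M" for y
    using that bij by (auto simp: g_def bij_betw_def inv_into_into f_inv_into_f)
  have gh: "g (h x) = x" if "x \<in> carrier L" for x
    using that bij ext by (auto simp: g_def bij_betw_def)
  have "g \<in> proper_homs M L"
  proof (rule order_isomorphism_proper[OF M L])
    show "g \<in> carrier M \<rightarrow>\<^sub>E carrier L" using gc by (auto simp: g_def)
    show "bij_betw g (carrier M) (carrier L)"
      by (rule bij_betw_byWitness[of _ h]) (use gc hg gh ext in auto)
    show "g x \<sqsubseteq>\<^bsub>L\<^esub> g y \<longleftrightarrow> x \<sqsubseteq>\<^bsub>M\<^esub> y" if "x \<in> carrier M" "y \<in> carrier M" for x y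
      using le[of "g x" "g y"] that by (simp add: gc hg)
  qed
  moreover have "compose (carrier L) g h = restrict (\<lambda>x. x) (carrier L)"
    "compose (carrier M) h g = restrict (\<lambda>x. x) (carrier M)"
    by (auto simp: compose_def gh hg fun_eq_iff)
  ultimately show ?thesis
    using order_isomorphism_proper[OF L M ext bij le]
    by (auto simp: is_isomorphism_def lattice_category_def)
qed

text \<open>A bijection matching the fundamental sets in both directions suffices: by
  \<open>strongly_continuousI\<close> these sets control the topology, for the map and for its
  inverse.\<close>

lemma homeomorphism_strongly_continuous:
  assumes X: "coherent X" and Y: "coherent Y"
    and ext: "h \<in> topspace X \<rightarrow>\<^sub>E topspace Y" and bij: "bij_betw h (topspace X) (topspace Y)"
    and fund: "\<And>A. A \<subseteq> topspace Y \<Longrightarrow> fundamental Y A \<longleftrightarrow> fundamental X {x \<in> topspace X. h x \<in> A}"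
  obtains g where "g \<in> strongly_continuous_maps Y X" "h \<in> strongly_continuous_maps X Y"
    "compose (topspace X) g h = restrict (\<lambda>x. x) (topspace X)"
    "compose (topspace Y) h g = restrict (\<lambda>x. x) (topspace Y)"
proof -
  define g where "g = restrict (inv_into (topspace X) h) (topspace Y)"
  have gc: "g y \<in> topspace X" and hg: "h (g y) = y" if "y \<in> topspace Y" for y
    using that bij by (auto simp: g_def bij_betw_def inv_into_into f_inv_into_f)
  have hc: "h x \<in> topspace Y" and gh: "g (h x) = x" if "x \<in> topspace X" for x
    using that bij ext by (auto simp: g_def bij_betw_def)
  have "g \<in> strongly_continuous_maps Y X"
  proof (rule strongly_continuousI[OF X _ _ Y])
    show "g \<in> topspace Y \<rightarrow>\<^sub>E topspace X" using gc by (auto simp: g_def)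
    fix A assume A: "fundamental X A"
    have "{x \<in> topspace X. h x \<in> {y \<in> topspace Y. g y \<in> A}} = A"
      using fundamental_subset_topspace[OF A] by (auto simp: hc gh)
    then show "fundamental Y {y \<in> topspace Y. g y \<in> A}"
      using A fund[of "{y \<in> topspace Y. g y \<in> A}"] by auto
  qed
  moreover have "h \<in> strongly_continuous_maps X Y"
    using strongly_continuousI[OF Y ext _ X] fund fundamental_subset_topspace by metis
  moreover have "compose (topspace X) g h = restrict (\<lambda>x. x) (topspace X)"
    "compose (topspace Y) h g = restrict (\<lambda>x. x) (topspace Y)"
    by (auto simp: compose_def gh hg fun_eq_iff)
  ultimately show thesis by (rule that)
qed

section \<open>The action of the spectrum on morphisms\<close>

definition spectrum_map :: "'a gorder \<Rightarrow> 'b gorder \<Rightarrow> ('a \<Rightarrow> 'b) \<Rightarrow> 'b set \<Rightarrow> 'a set" where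
  "spectrum_map L M f = (\<lambda>P\<in>topspace (prime_spectrum M). {x \<in> carrier L. f x \<in> P})"

text \<open>The inverse image of \<open>P\<close> omits \<open>a\<close> exactly when
  \<open>P\<close> omits \<open>f a\<close>. This identity yields both strong continuity of the
  spectrum map and naturality of the unit.\<close>

lemma spectrum_map_vimage:
  assumes L: "distributive_lattice L" and M: "distributive_lattice M"
    and f: "f \<in> proper_homs L M" and a: "a \<in> carrier L"
  shows "{P \<in> topspace (prime_spectrum M). spectrum_map L M f P \<in> basic_open L a} = basic_open M (f a)"
proof -
  interpret M: distr_lattice M using M by (simp add: distributive_lattice_iff)
  show ?thesis
    using a proper_homs_vimage[OF f]
    by (auto simp: spectrum_map_def M.topspace_prime_spectrum basic_open_def)
qed

lemma spectrum_map_strongly_continuous: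
  assumes L: "distributive_lattice L" and M: "distributive_lattice M"
    and f: "f \<in> proper_homs L M"
  shows "spectrum_map L M f \<in> strongly_continuous_maps (prime_spectrum M) (prime_spectrum L)"
proof -
  interpret L: distr_lattice L using L by (simp add: distributive_lattice_iff)
  interpret M: distr_lattice M using M by (simp add: distributive_lattice_iff)
  show ?thesis
  proof (rule strongly_continuousI)
    show "spectrum_map L M f \<in> topspace (prime_spectrum M) \<rightarrow>\<^sub>E topspace (prime_spectrum L)"
      using proper_homs_vimage[OF f]
      by (auto simp: spectrum_map_def M.topspace_prime_spectrum L.topspace_prime_spectrum)
    fix A assume "fundamental (prime_spectrum L) A"
    then obtain a where a: "a \<in> carrier L" "A = basic_open L a"
      using L.fundamental_prime_spectrum_eq by blast
    show "fundamental (prime_spectrum M) {P \<in> topspace (prime_spectrum M). spectrum_map L M f P \<in> A}"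
      unfolding a(2) spectrum_map_vimage[OF L M f a(1)]
      using proper_homs_mem[OF f a(1)] by (rule M.fundamental_basic_open)
  qed (rule L.coherent_prime_spectrum M.coherent_prime_spectrum)+
qed

lemma spectrum_map_id:
  assumes "distributive_lattice L"
  shows "spectrum_map L L (restrict (\<lambda>x. x) (carrier L)) = restrict (\<lambda>x. x) (topspace (prime_spectrum L))"
proof -
  interpret distr_lattice L using assms by (simp add: distributive_lattice_iff)
  have "{x \<in> carrier L. restrict (\<lambda>x. x) (carrier L) x \<in> P} = P" if "prime_lattice_ideal L P" for P
    using prime_ideal_subset[OF that] by auto
  then show ?thesis
    unfolding spectrum_map_def by (intro restrict_ext) (simp add: topspace_prime_spectrum)
qed

lemma spectrum_map_compose:
  assumes "distributive_lattice M" "distributive_lattice N"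
    and f: "f \<in> proper_homs L M" and g: "g \<in> proper_homs M N"
  shows "spectrum_map L N (compose (carrier L) g f) =
    compose (topspace (prime_spectrum N)) (spectrum_map L M f) (spectrum_map M N g)"
proof -
  interpret M: distr_lattice M using assms by (simp add: distributive_lattice_iff)
  interpret N: distr_lattice N using assms by (simp add: distributive_lattice_iff)
  show ?thesis
    unfolding spectrum_map_def compose_def
    using proper_homs_vimage[OF g] proper_homs_mem[OF f]
    by (intro restrict_ext) (auto simp: M.topspace_prime_spectrum N.topspace_prime_spectrum)
qed

section \<open>The lattice of fundamental subsets and its spectrum\<close>

definition fundamental_lattice :: "('b topology \<Rightarrow> 'b set \<Rightarrow> 'a) \<Rightarrow> 'b topology \<Rightarrow> 'a gorder" where
  "fundamental_lattice e X = set_lattice (e X) (fundamentals X)"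

text \<open>Inverse image of fundamental sets, conjugated by the encodings: decode in
  \<open>Y\<close>, pull back along \<open>f\<close>, encode in \<open>X\<close>.\<close>

definition pullback ::
  "('b topology \<Rightarrow> 'b set \<Rightarrow> 'a) \<Rightarrow> 'b topology \<Rightarrow> 'b topology \<Rightarrow> ('b \<Rightarrow> 'b) \<Rightarrow> 'a \<Rightarrow> 'a" where
  "pullback e X Y f = (\<lambda>a\<in>e Y ` fundamentals Y.
     e X {x \<in> topspace X. f x \<in> inv_into (fundamentals Y) (e Y) a})"

definition point_ideal :: "('b topology \<Rightarrow> 'b set \<Rightarrow> 'a) \<Rightarrow> 'b topology \<Rightarrow> 'b \<Rightarrow> 'a set" where
  "point_ideal e X = (\<lambda>x\<in>topspace X. e X ` {U. fundamental X U \<and> x \<notin> U})"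

locale encoded_space = almost_spectral_space X
  for e :: "'b topology \<Rightarrow> 'b set \<Rightarrow> 'a" and X :: "'b topology" +
  assumes inj_encoding: "inj_on (e X) (fundamentals X)"
begin

sublocale K: encoded_set_lattice "e X" "fundamentals X"
  by (rule encoded_fundamental[OF inj_encoding])

lemma distributive_fundamental_lattice: "distributive_lattice (fundamental_lattice e X)"
  unfolding fundamental_lattice_def by (rule K.distributive)

lemma carrier_fundamental_lattice: "carrier (fundamental_lattice e X) = e X ` fundamentals X"
  unfolding fundamental_lattice_def by simp

lemma encode_mem_point_ideal_iff:
  "\<lbrakk>fundamental X U; x \<in> topspace X\<rbrakk> \<Longrightarrow> e X U \<in> point_ideal e X x \<longleftrightarrow> x \<notin> U"
  using inj_encoding by (auto simp: point_ideal_def inj_on_eq_iff)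

lemma prime_ideal_point_ideal:
  "x \<in> topspace X \<Longrightarrow> prime_lattice_ideal (fundamental_lattice e X) (point_ideal e X x)"
  unfolding fundamental_lattice_def point_ideal_def
  using prime_set_ideal_of_point by (simp add: K.prime_ideal_encode_iff Collect_mono)

lemma prime_ideal_is_point_ideal:
  assumes "prime_lattice_ideal (fundamental_lattice e X) P"
  obtains x where "x \<in> topspace X" "P = point_ideal e X x"
proof -
  obtain Q where Q: "prime_set_ideal (fundamentals X) Q" "P = e X ` Q"
    using assms unfolding fundamental_lattice_def by (rule K.prime_ideal_decode)
  obtain x where "x \<in> topspace X" "Q = {U. fundamental X U \<and> x \<notin> U}"
    using Q(1) by (rule point_of_fundamental_ideal)
  then show thesis using that Q(2) by (simp add: point_ideal_def)
qed

text \<open>Injectivity is the T0 axiom, seen through the basis of fundamental sets; surjectivity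
  says that every prime ideal comes from a point.\<close>

lemma bij_point_ideal:
  "bij_betw (point_ideal e X) (topspace X) (topspace (prime_spectrum (fundamental_lattice e X)))"
  unfolding bij_betw_def
proof
  interpret L: distr_lattice "fundamental_lattice e X"
    using distributive_fundamental_lattice by (simp add: distributive_lattice_iff)
  show "inj_on (point_ideal e X) (topspace X)"
    by (intro inj_onI fundamental_separation) (use encode_mem_point_ideal_iff in blast)+
  show "point_ideal e X ` topspace X = topspace (prime_spectrum (fundamental_lattice e X))"
    unfolding L.topspace_prime_spectrum
    using prime_ideal_point_ideal by (auto elim: prime_ideal_is_point_ideal)
qed

lemma point_ideal_vimage:
  assumes "fundamental X U"
  shows "{x \<in> topspace X. point_ideal e X x \<in> basic_open (fundamental_lattice e X) (e X U)} = U"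
  using prime_ideal_point_ideal encode_mem_point_ideal_iff[OF assms] fundamental_subset_topspace[OF assms]
  by (auto simp: basic_open_def)

lemma isomorphism_point_ideal:
  obtains g where "g \<in> strongly_continuous_maps (prime_spectrum (fundamental_lattice e X)) X"
    "point_ideal e X \<in> strongly_continuous_maps X (prime_spectrum (fundamental_lattice e X))"
    "compose (topspace X) g (point_ideal e X) = restrict (\<lambda>x. x) (topspace X)"
    "compose (topspace (prime_spectrum (fundamental_lattice e X))) (point_ideal e X) g =
      restrict (\<lambda>x. x) (topspace (prime_spectrum (fundamental_lattice e X)))"
proof (rule homeomorphism_strongly_continuous)
  interpret L: distr_lattice "fundamental_lattice e X"
    using distributive_fundamental_lattice by (simp add: distributive_lattice_iff)
  let ?Y = "prime_spectrum (fundamental_lattice e X)"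
  show "coherent X" by (rule coherent)
  show "coherent ?Y" by (rule L.coherent_prime_spectrum)
  show bij: "bij_betw (point_ideal e X) (topspace X) (topspace ?Y)" by (rule bij_point_ideal)
  show "point_ideal e X \<in> topspace X \<rightarrow>\<^sub>E topspace ?Y"
    using bij by (auto simp: bij_betw_def point_ideal_def)
  fix A assume A: "A \<subseteq> topspace ?Y"
  show "fundamental ?Y A \<longleftrightarrow> fundamental X {x \<in> topspace X. point_ideal e X x \<in> A}"
  proof
    assume "fundamental ?Y A"
    then have "A \<in> basic_open (fundamental_lattice e X) ` e X ` fundamentals X"
      by (simp flip: L.fundamental_prime_spectrum_eq carrier_fundamental_lattice)
    then obtain U where "fundamental X U" "A = basic_open (fundamental_lattice e X) (e X U)"
      by auto
    then show "fundamental X {x \<in> topspace X. point_ideal e X x \<in> A}"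
      by (simp add: point_ideal_vimage)
  next
    assume U: "fundamental X {x \<in> topspace X. point_ideal e X x \<in> A}"
    define U where "U = {x \<in> topspace X. point_ideal e X x \<in> A}"
    \<comment> \<open>The basic set belonging to \<open>U\<close>. It has the same inverse image as
      \<open>A\<close> under the bijection, so \<open>A\<close> equals it and is
      fundamental.\<close>
    define B where "B = basic_open (fundamental_lattice e X) (e X U)"
    have eU: "e X U \<in> carrier (fundamental_lattice e X)"
      using U by (simp add: U_def carrier_fundamental_lattice)
    have B: "fundamental ?Y B" unfolding B_def using eU by (rule L.fundamental_basic_open)
    have "{x \<in> topspace X. point_ideal e X x \<in> B} = {x \<in> topspace X. point_ideal e X x \<in> A}"
      unfolding B_def using point_ideal_vimage U by (simp add: U_def)
    moreover have "B \<subseteq> point_ideal e X ` topspace X" "A \<subseteq> point_ideal e X ` topspace X"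
      using bij A fundamental_subset_topspace[OF B] by (simp_all add: bij_betw_def)
    ultimately have "A = B" by blast
    then show "fundamental ?Y A" using B by simp
  qed
qed (rule that)

end

lemma pullback_encode:
  assumes "encoded_space e Y" "fundamental Y U"
  shows "pullback e X Y f (e Y U) = e X {x \<in> topspace X. f x \<in> U}"
proof -
  interpret Y: encoded_space e Y by fact
  show ?thesis using assms(2) Y.inj_encoding by (simp add: pullback_def)
qed

text \<open>Inverse images commute with unions and intersections. For properness, a prime ideal of
  the lattice of \<open>X\<close> is the ideal of some point \<open>x\<close>, and its inverse image
  is the ideal of \<open>f x\<close>, which is already known to be prime.\<close>

lemma pullback_proper:
  assumes X: "encoded_space e X" and Y: "encoded_space e Y"
    and f: "f \<in> strongly_continuous_maps X Y"
  shows "pullback e X Y f \<in> proper_homs (fundamental_lattice e Y) (fundamental_lattice e X)"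
proof -
  interpret X: encoded_space e X by fact
  interpret Y: encoded_space e Y by fact
  note pb = pullback_encode[OF Y] and fv = strongly_continuous_maps_vimage[OF f]
  have "pullback e X Y f \<in> lattice_homs (fundamental_lattice e Y) (fundamental_lattice e X)"
    unfolding lattice_homs_def X.carrier_fundamental_lattice Y.carrier_fundamental_lattice
  proof (intro CollectI conjI ballI)
    show "pullback e X Y f \<in> e Y ` fundamentals Y \<rightarrow>\<^sub>E e X ` fundamentals X"
    proof (rule PiE_I)
      show "pullback e X Y f a \<in> e X ` fundamentals X" if "a \<in> e Y ` fundamentals Y" for a
        using that fv by (auto simp: pb)
    qed (simp add: pullback_def)
    fix a b assume "a \<in> e Y ` fundamentals Y" "b \<in> e Y ` fundamentals Y"
    then obtain U V where UV: "fundamental Y U" "fundamental Y V" "a = e Y U" "b = e Y V" by auto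
    show "pullback e X Y f (a \<sqinter>\<^bsub>fundamental_lattice e Y\<^esub> b) =
        pullback e X Y f a \<sqinter>\<^bsub>fundamental_lattice e X\<^esub> pullback e X Y f b"
    proof -
      have "{x \<in> topspace X. f x \<in> U \<inter> V} = {x \<in> topspace X. f x \<in> U} \<inter> {x \<in> topspace X. f x \<in> V}"
        by blast
      then show ?thesis
        using UV by (simp add: fundamental_lattice_def pb X.K.meet_eq Y.K.meet_eq fv Y.fundamental_Int
            del: Int_iff)
    qed
    show "pullback e X Y f (a \<squnion>\<^bsub>fundamental_lattice e Y\<^esub> b) =
        pullback e X Y f a \<squnion>\<^bsub>fundamental_lattice e X\<^esub> pullback e X Y f b"
    proof -
      have "{x \<in> topspace X. f x \<in> U \<union> V} = {x \<in> topspace X. f x \<in> U} \<union> {x \<in> topspace X. f x \<in> V}"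
        by blast
      then show ?thesis
        using UV by (simp add: fundamental_lattice_def pb X.K.join_eq Y.K.join_eq fv Y.fundamental_Un
            del: Un_iff)
    qed
  qed
  moreover have "prime_lattice_ideal (fundamental_lattice e Y)
      {a \<in> carrier (fundamental_lattice e Y). pullback e X Y f a \<in> P}"
    if P: "prime_lattice_ideal (fundamental_lattice e X) P" for P
  proof -
    obtain x where x: "x \<in> topspace X" "P = point_ideal e X x"
      using P by (rule X.prime_ideal_is_point_ideal)
    have fx: "f x \<in> topspace Y" using strongly_continuous_maps_mem f x(1) .
    have "{a \<in> carrier (fundamental_lattice e Y). pullback e X Y f a \<in> P} = point_ideal e Y (f x)"
      unfolding Y.carrier_fundamental_lattice x(2)
      using x(1) fx by (auto simp: pb fv X.encode_mem_point_ideal_iff point_ideal_def[of e Y])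
    then show ?thesis using Y.prime_ideal_point_ideal[OF fx] by simp
  qed
  ultimately show ?thesis by (simp add: proper_homs_def)
qed

lemma pullback_id:
  assumes "encoded_space e X"
  shows "pullback e X X (restrict (\<lambda>x. x) (topspace X)) =
    restrict (\<lambda>x. x) (carrier (fundamental_lattice e X))"
proof -
  interpret X: encoded_space e X by fact
  have "{x \<in> topspace X. restrict (\<lambda>x. x) (topspace X) x \<in> U} = U" if "fundamental X U" for U
    using fundamental_subset_topspace[OF that] by auto
  then have "pullback e X X (restrict (\<lambda>x. x) (topspace X)) a = a" if "a \<in> e X ` fundamentals X" for a
    using that pullback_encode[OF assms] by auto
  then show ?thesis
    unfolding X.carrier_fundamental_lattice by (auto simp: fun_eq_iff pullback_def)
qed

lemma pullback_compose:
  assumes X: "encoded_space e X" and Y: "encoded_space e Y" and Z: "encoded_space e Z"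
    and f: "f \<in> strongly_continuous_maps X Y" and g: "g \<in> strongly_continuous_maps Y Z"
  shows "pullback e X Z (compose (topspace X) g f) =
    compose (carrier (fundamental_lattice e Z)) (pullback e X Y f) (pullback e Y Z g)"
proof
  fix a
  interpret Z: encoded_space e Z by fact
  show "pullback e X Z (compose (topspace X) g f) a =
    compose (carrier (fundamental_lattice e Z)) (pullback e X Y f) (pullback e Y Z g) a"
  proof (cases "a \<in> e Z ` fundamentals Z")
    case True
    then obtain U where U: "fundamental Z U" "a = e Z U" by auto
    have "{x \<in> topspace X. compose (topspace X) g f x \<in> U} =
        {x \<in> topspace X. f x \<in> {y \<in> topspace Y. g y \<in> U}}"
      using strongly_continuous_maps_mem[OF f] by (auto simp: compose_def)
    then show ?thesis
      using U strongly_continuous_maps_vimage[OF g U(1)]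
      by (simp add: compose_def Z.carrier_fundamental_lattice pullback_encode[OF Z] pullback_encode[OF Y])
  qed (simp add: pullback_def compose_def Z.carrier_fundamental_lattice)
qed

text \<open>Chosen separately for each space, but as a total function of \<open>X\<close>, so that
  taking the encoded lattice is an operation on objects. Smallness of the image makes that lattice
  small.\<close>

definition encoding :: "('a set \<Rightarrow> bool) \<Rightarrow> 'b topology \<Rightarrow> 'b set \<Rightarrow> 'a" where
  "encoding small X = (SOME e. inj_on e (fundamentals X) \<and> small (e ` fundamentals X))"

text \<open>Isolates what depends on the bounds: \<open>P\<close> will be existence of a minimum or
  of a maximum, and \<open>Q\<close> the matching spectrality. The last assumption ranges over all
  injective encodings, so an instance need not know which one was chosen.\<close>

locale stone_duality =
  fixes small :: "'a set \<Rightarrow> bool" and P :: "'a gorder \<Rightarrow> bool" and Q :: "'a set topology \<Rightarrow> bool"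
  assumes small: "size_notion small"
    and almost_spectral: "Q X \<Longrightarrow> almost_spectral_space X"
    and spectrum: "\<lbrakk>distributive_lattice L; P L\<rbrakk> \<Longrightarrow> Q (prime_spectrum L)"
    and lattice: "\<lbrakk>Q X; inj_on e (fundamentals X)\<rbrakk> \<Longrightarrow> P (set_lattice e (fundamentals X))"
begin

abbreviation "enc \<equiv> encoding small :: 'a set topology \<Rightarrow> 'a set set \<Rightarrow> 'a"

abbreviation "K \<equiv> fundamental_lattice enc"

lemma encoding:
  assumes "small_space small X"
  shows "inj_on (enc X) (fundamentals X)" "small (enc X ` fundamentals X)"
proof -
  obtain A where A: "small A" "fundamentals X \<lesssim> A"
    using assms by (auto simp: small_space_def)
  then obtain e where e: "inj_on e (fundamentals X)" "e ` fundamentals X \<subseteq> A"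
    by (auto simp: lepoll_def)
  have "small (e ` fundamentals X)"
    using small A(1) subset_imp_lepoll[OF e(2)] unfolding size_notion_def by blast
  with e(1) have "\<exists>e::'a set set \<Rightarrow> 'a. inj_on e (fundamentals X) \<and> small (e ` fundamentals X)" by blast
  from someI_ex[OF this] show "inj_on (enc X) (fundamentals X)" "small (enc X ` fundamentals X)"
    unfolding encoding_def by blast+
qed

lemma encoded_space: "\<lbrakk>Q X; small_space small X\<rbrakk> \<Longrightarrow> encoded_space enc X"
  by (intro encoded_space.intro encoded_space_axioms.intro almost_spectral encoding)

text \<open>The fundamental sets are the image of the carrier under \<open>basic_open L\<close>, so
  the carrier itself bounds their number.\<close>

lemma small_prime_spectrum:
  assumes "distributive_lattice L" "small_lattice small L"
  shows "small_space small (prime_spectrum L)"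
proof -
  interpret distr_lattice L using assms by (simp add: distributive_lattice_iff)
  show ?thesis
    using assms(2) image_lepoll unfolding small_space_def small_lattice_def fundamental_prime_spectrum_eq
    by blast
qed

lemma spectrum_object:
  assumes "distributive_lattice L" "P L" "small_lattice small L"
  shows "Q (prime_spectrum L)" "small_space small (prime_spectrum L)"
    "encoded_space enc (prime_spectrum L)"
  using assms spectrum small_prime_spectrum encoded_space by blast+

lemma lattice_object:
  assumes "Q X" "small_space small X"
  shows "distributive_lattice (K X)" "P (K X)" "small_lattice small (K X)"
proof -
  interpret encoded_space enc X using assms by (rule encoded_space)
  show "distributive_lattice (K X)" by (rule distributive_fundamental_lattice)
  show "P (K X)" unfolding fundamental_lattice_def using assms(1) inj_encoding by (rule lattice)
  show "small_lattice small (K X)"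
    using encoding(2)[OF assms(2)] by (simp add: small_lattice_def carrier_fundamental_lattice)
qed

section \<open>The two functors, unit and counit\<close>

definition spectrum_functor :: "('a gorder, 'a \<Rightarrow> 'a, 'a set topology, 'a set \<Rightarrow> 'a set) funct" where
  "spectrum_functor = \<lparr>on_obj = prime_spectrum, on_hom = spectrum_map\<rparr>"

text \<open>A morphism from \<open>X\<close> to \<open>Y\<close> in the opposite category is a map
  from \<open>Y\<close> to \<open>X\<close>, hence the exchanged arguments of
  \<open>pullback\<close>.\<close>

definition lattice_functor :: "('a set topology, 'a set \<Rightarrow> 'a set, 'a gorder, 'a \<Rightarrow> 'a) funct" where
  "lattice_functor = \<lparr>on_obj = K, on_hom = (\<lambda>X Y f. pullback enc Y X f)\<rparr>"

abbreviation "lattices \<equiv> lattice_category small P"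

abbreviation "spaces \<equiv> space_category small Q"

lemma functor_spectrum: "is_functor lattices (opposite spaces) spectrum_functor"
  unfolding is_functor_def lattice_category_def space_category_def opposite_def spectrum_functor_def
    category.simps funct.simps
proof (intro conjI ballI; (elim CollectE conjE)?)
  show "prime_spectrum L \<in> {X. Q X \<and> small_space small X}"
    if "distributive_lattice L" "P L" "small_lattice small L" for L
    using spectrum_object[OF that] by simp
qed (simp_all add: spectrum_map_strongly_continuous spectrum_map_id spectrum_map_compose)

lemma functor_lattice: "is_functor (opposite spaces) lattices lattice_functor"
  unfolding is_functor_def lattice_category_def space_category_def opposite_def lattice_functor_def
    category.simps funct.simps
proof (intro conjI ballI; (elim CollectE conjE)?)
  show "K X \<in> {L. distributive_lattice L \<and> P L \<and> small_lattice small L}"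
    if "Q X" "small_space small X" for X
    using lattice_object[OF that] by simp
qed (simp_all add: encoded_space pullback_proper pullback_id pullback_compose)

definition unit :: "'a gorder \<Rightarrow> 'a \<Rightarrow> 'a" where
  "unit L = (\<lambda>a\<in>carrier L. enc (prime_spectrum L) (basic_open L a))"

text \<open>The unit is onto because every fundamental set of the spectrum is a basic set, and it
  preserves and reflects the order because \<open>basic_open L\<close> does.\<close>

lemma isomorphism_unit:
  assumes "distributive_lattice L" "P L" "small_lattice small L"
  shows "is_isomorphism lattices L (K (prime_spectrum L)) (unit L)"
proof -
  interpret L: distr_lattice L using assms by (simp add: distributive_lattice_iff)
  interpret X: encoded_space enc "prime_spectrum L" by (rule spectrum_object[OF assms])
  have carrier: "carrier (K (prime_spectrum L)) = enc (prime_spectrum L) ` basic_open L ` carrier L"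
    unfolding X.carrier_fundamental_lattice L.fundamental_prime_spectrum_eq ..
  show ?thesis
  proof (rule isomorphism_lattice_category)
    show "unit L \<in> carrier L \<rightarrow>\<^sub>E carrier (K (prime_spectrum L))"
      unfolding unit_def carrier by auto
    show "bij_betw (unit L) (carrier L) (carrier (K (prime_spectrum L)))"
      unfolding bij_betw_def carrier unit_def
      by (auto intro!: inj_onI simp: L.fundamental_basic_open L.basic_open_eq_iff image_image)
    show "unit L a \<sqsubseteq>\<^bsub>K (prime_spectrum L)\<^esub> unit L b \<longleftrightarrow> a \<sqsubseteq>\<^bsub>L\<^esub> b"
      if "a \<in> carrier L" "b \<in> carrier L" for a b
      using that
      by (simp add: unit_def fundamental_lattice_def L.fundamental_basic_open L.basic_open_subset_iff)
  qed (rule assms X.distributive_fundamental_lattice)+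
qed

text \<open>Both sides send \<open>a\<close> to the code of
  \<open>basic_open M (f a)\<close>.\<close>

lemma unit_natural:
  assumes L: "distributive_lattice L" "P L" "small_lattice small L"
    and M: "distributive_lattice M" "P M" "small_lattice small M"
    and f: "f \<in> proper_homs L M"
  shows "compose (carrier L) (pullback enc (prime_spectrum M) (prime_spectrum L) (spectrum_map L M f)) (unit L) =
    compose (carrier L) (unit M) f"
proof -
  interpret L: distr_lattice L using L by (simp add: distributive_lattice_iff)
  have "pullback enc (prime_spectrum M) (prime_spectrum L) (spectrum_map L M f) (unit L a) = unit M (f a)"
    if a: "a \<in> carrier L" for a
    using a proper_homs_mem[OF f a] spectrum_map_vimage[OF L(1) M(1) f a]
      pullback_encode[OF spectrum_object(3)[OF L] L.fundamental_basic_open[OF a]]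
    by (simp add: unit_def)
  then show ?thesis unfolding compose_def by (rule restrict_ext)
qed

lemma naturally_isomorphic_unit:
  "naturally_isomorphic lattices lattices id_functor (comp_functor lattice_functor spectrum_functor)"
  unfolding naturally_isomorphic_def
proof (intro exI[of _ unit] conjI ballI)
  fix L assume "L \<in> Obj lattices"
  then have L: "distributive_lattice L" "P L" "small_lattice small L"
    by (simp_all add: lattice_category_def)
  show "is_isomorphism lattices (on_obj id_functor L)
      (on_obj (comp_functor lattice_functor spectrum_functor) L) (unit L)"
    using isomorphism_unit[OF L]
    by (simp add: id_functor_def comp_functor_def lattice_functor_def spectrum_functor_def)
  fix M f assume "M \<in> Obj lattices" "f \<in> Hom lattices L M"
  then have M: "distributive_lattice M" "P M" "small_lattice small M" and f: "f \<in> proper_homs L M"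
    by (simp_all add: lattice_category_def)
  show "Comp lattices (on_obj id_functor L) (on_obj (comp_functor lattice_functor spectrum_functor) L)
      (on_obj (comp_functor lattice_functor spectrum_functor) M)
      (on_hom (comp_functor lattice_functor spectrum_functor) L M f) (unit L) =
    Comp lattices (on_obj id_functor L) (on_obj id_functor M)
      (on_obj (comp_functor lattice_functor spectrum_functor) M) (unit M) (on_hom id_functor L M f)"
    using unit_natural[OF L M f]
    by (simp add: id_functor_def comp_functor_def lattice_functor_def spectrum_functor_def
        lattice_category_def)
qed

text \<open>As a map, \<open>point_ideal enc X\<close> goes from \<open>X\<close> to the spectrum;
  read in the opposite category it is an arrow into \<open>X\<close>.\<close>

lemma isomorphism_counit:
  assumes "Q X" "small_space small X"
  shows "is_isomorphism (opposite spaces) (prime_spectrum (K X)) X (point_ideal enc X)"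
proof -
  interpret encoded_space enc X using assms by (rule encoded_space)
  show ?thesis
    by (rule isomorphism_point_ideal)
       (auto simp: is_isomorphism_def opposite_def space_category_def)
qed

text \<open>Both sides send \<open>y\<close> to the ideal of encoded fundamental sets of
  \<open>X\<close> that miss \<open>f y\<close>.\<close>

lemma counit_natural:
  assumes X: "Q X" "small_space small X" and Y: "Q Y" "small_space small Y"
    and f: "f \<in> strongly_continuous_maps Y X"
  shows "compose (topspace Y) (point_ideal enc X) f =
    compose (topspace Y) (spectrum_map (K X) (K Y) (pullback enc Y X f)) (point_ideal enc Y)"
proof -
  interpret X: encoded_space enc X using X by (rule encoded_space)
  interpret Y: encoded_space enc Y using Y by (rule encoded_space)
  have "point_ideal enc X (f y) = spectrum_map (K X) (K Y) (pullback enc Y X f) (point_ideal enc Y y)"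
    if y: "y \<in> topspace Y" for y
  proof -
    have fy: "f y \<in> topspace X" using strongly_continuous_maps_mem f y .
    have "point_ideal enc Y y \<in> topspace (prime_spectrum (K Y))"
      using Y.bij_point_ideal y by (auto simp: bij_betw_def)
    then show ?thesis
      using y fy strongly_continuous_maps_vimage[OF f]
      by (auto simp: spectrum_map_def X.carrier_fundamental_lattice pullback_encode[OF X.encoded_space_axioms]
          Y.encode_mem_point_ideal_iff point_ideal_def[of enc X])
  qed
  then show ?thesis unfolding compose_def by (rule restrict_ext)
qed

lemma naturally_isomorphic_counit:
  "naturally_isomorphic (opposite spaces) (opposite spaces)
    (comp_functor spectrum_functor lattice_functor) id_functor"
  unfolding naturally_isomorphic_def
proof (intro exI[of _ "point_ideal enc"] conjI ballI)
  fix X assume "X \<in> Obj (opposite spaces)"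
  then have X: "Q X" "small_space small X"
    by (simp_all add: opposite_def space_category_def)
  show "is_isomorphism (opposite spaces) (on_obj (comp_functor spectrum_functor lattice_functor) X)
      (on_obj id_functor X) (point_ideal enc X)"
    using isomorphism_counit[OF X]
    by (simp add: id_functor_def comp_functor_def lattice_functor_def spectrum_functor_def)
  fix Y f assume "Y \<in> Obj (opposite spaces)" "f \<in> Hom (opposite spaces) X Y"
  then have Y: "Q Y" "small_space small Y" and f: "f \<in> strongly_continuous_maps Y X"
    by (simp_all add: opposite_def space_category_def)
  show "Comp (opposite spaces) (on_obj (comp_functor spectrum_functor lattice_functor) X)
      (on_obj id_functor X) (on_obj id_functor Y) (on_hom id_functor X Y f) (point_ideal enc X) =
    Comp (opposite spaces) (on_obj (comp_functor spectrum_functor lattice_functor) X)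
      (on_obj (comp_functor spectrum_functor lattice_functor) Y) (on_obj id_functor Y)
      (point_ideal enc Y) (on_hom (comp_functor spectrum_functor lattice_functor) X Y f)"
    using counit_natural[OF X Y f]
    by (simp add: id_functor_def comp_functor_def lattice_functor_def spectrum_functor_def
        opposite_def space_category_def)
qed

theorem co_equivalent_lattices_spaces: "co_equivalent lattices spaces"
  unfolding co_equivalent_def equivalent_categories_def
  using category_lattice_category category_opposite[OF category_space_category]
    functor_spectrum functor_lattice naturally_isomorphic_unit naturally_isomorphic_counit
  by blast

end

section \<open>The two instances: minimum with soberness, maximum with compactness\<close>

lemma almost_spectral_up_spectral: "up_spectral X \<Longrightarrow> almost_spectral_space X"
  by unfold_locales
     (auto simp: up_spectral_def intro: sober_imp_almost_sober sober_imp_t0_space)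

lemma almost_spectral_down_spectral: "down_spectral X \<Longrightarrow> almost_spectral_space X"
  by unfold_locales (auto simp: down_spectral_def)

lemma up_spectral_prime_spectrum:
  "\<lbrakk>distributive_lattice L; has_minimum L\<rbrakk> \<Longrightarrow> up_spectral (prime_spectrum L)"
  by (simp add: distributive_lattice_iff up_spectral_def distr_lattice.coherent_prime_spectrum
      distr_lattice.sober_prime_spectrum)

lemma down_spectral_prime_spectrum:
  "\<lbrakk>distributive_lattice L; has_maximum L\<rbrakk> \<Longrightarrow> down_spectral (prime_spectrum L)"
  by (simp add: distributive_lattice_iff down_spectral_def distr_lattice.coherent_prime_spectrum
      distr_lattice.almost_sober_prime_spectrum distr_lattice.t0_prime_spectrum
      distr_lattice.compact_space_prime_spectrum)

lemma has_minimum_fundamentals: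
  assumes X: "up_spectral X" and e: "inj_on e (fundamentals X)"
  shows "has_minimum (set_lattice e (fundamentals X))"
proof -
  interpret almost_spectral_space X using X by (rule almost_spectral_up_spectral)
  interpret K: encoded_set_lattice e "fundamentals X" using e by (rule encoded_fundamental)
  have "fundamental X {}"
    using X by (intro fundamental_emptyI_sober) (simp add: up_spectral_def)
  then have "least (set_lattice e (fundamentals X)) (e {}) (carrier (set_lattice e (fundamentals X)))"
    by (auto simp: least_def)
  then show ?thesis by (auto simp: has_minimum_def)
qed

lemma has_maximum_fundamentals:
  assumes X: "down_spectral X" and e: "inj_on e (fundamentals X)"
  shows "has_maximum (set_lattice e (fundamentals X))"
proof -
  interpret almost_spectral_space X using X by (rule almost_spectral_down_spectral)
  interpret K: encoded_set_lattice e "fundamentals X" using e by (rule encoded_fundamental)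
  have "fundamental X (topspace X)"
  \<comment> \<open>The empty space is compact, but the first clause of \<open>fundamental\<close>
    asks for a non-empty set. Some set is fundamental, and there it can only be the empty
    one.\<close>
  proof (cases "topspace X = {}")
    case True
    obtain U where U: "fundamental X U" using fundamental_exists by blast
    then have "U = {}" using True fundamental_subset_topspace by blast
    then show ?thesis using U True by simp
  next
    case False
    then show ?thesis
      using X by (simp add: fundamental_nonempty_iff compact_open_def down_spectral_def compact_space_def)
  qed
  then have "greatest (set_lattice e (fundamentals X)) (e (topspace X)) (carrier (set_lattice e (fundamentals X)))"
    by (auto simp: greatest_def dest: fundamental_subset_topspace)
  then show ?thesis by (auto simp: has_maximum_def)
qed

theorem corollary4:
  fixes small :: "'a set \<Rightarrow> bool"
  assumes "size_notion small"
  shows "co_equivalent (D_min small) (US small) \<and>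
         co_equivalent (D_max small) (DS small)"
proof
  interpret up: stone_duality small has_minimum up_spectral
    by (intro stone_duality.intro assms almost_spectral_up_spectral up_spectral_prime_spectrum
        has_minimum_fundamentals)
  show "co_equivalent (D_min small) (US small)"
    unfolding D_min_def US_def by (rule up.co_equivalent_lattices_spaces)
  interpret down: stone_duality small has_maximum down_spectral
    by (intro stone_duality.intro assms almost_spectral_down_spectral down_spectral_prime_spectrum
        has_maximum_fundamentals)
  show "co_equivalent (D_max small) (DS small)"
    unfolding D_max_def DS_def by (rule down.co_equivalent_lattices_spaces)
qed

end
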